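(* Let $\dot A$ be a non-negative symmetric Schrödinger operator $\dot A y=-y''+q(x)y$, $y(\ell)=y'(\ell)=0$, in $L_2[\ell,+\infty)$, with real locally summable potential $q$ and deficiency indices $(1,1)$. Let $m_\infty(z)$ be its Weyl-Titchmarsh function, assume that $m_\infty(-0)$ is finite, and for real $\alpha$ let $$m_\alpha(z)=\frac{\sin\alpha+m_\infty(z)\cos\alpha}{\cos\alpha-m_\infty(z)\sin\alpha}.$$ Then: (1) the function $1/m_\infty(z)$ is Stieltjes if and only if $m_\infty(-0)\ge0$; (2) the function $-m_\infty(z)$ is inverse Stieltjes if and only if $m_\infty(-0)\ge0$; (3) the function $-m_\alpha(z)$ is Stieltjes if and only if $$0<\frac1{m_\infty(-0)}\le\tan\alpha,$$ and it is inverse Stieltjes if and only if $$-m_\infty(-0)\le\tan\alpha\le0.$$ Here $1/m_\infty(-0)=+\infty$ if $m_\infty(-0)=0$, and $\tan\alpha=+\infty$ if $\cos\alpha=0$.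
   Context: Setting. Let $\ell\ge 0$, $l(y)=-y''+q(x)y$ with $q$ real and locally summable on $[\ell,+\infty)$. $\dot A$ is the minimal symmetric operator $\dot A y=l(y)$ with $y(\ell)=y'(\ell)=0$ in $L_2[\ell,+\infty)$, assumed to have deficiency indices $(1,1)$. Its adjoint $\dot A^*$ acts as $l$ on all $y\in L_2[\ell,+\infty)$ that are locally absolutely continuous together with $y'$ and satisfy $l(y)\in L_2[\ell,+\infty)$. Non-negativity means $(\dot A f,f)\ge0$ for all $f\in\mathrm{Dom}(\dot A)$. Weyl-Titchmarsh function. Let $\varphi_1,\varphi_2$ solve $l(\varphi_k)=z\varphi_k$ with $\varphi_1(\ell,z)=0,\ \varphi_1'(\ell,z)=1$ and $\varphi_2(\ell,z)=-1,\ \varphi_2'(\ell,z)=0$. Then $m_\infty(z)$ is the function for which $\varphi_2(x,z)+m_\infty(z)\varphi_1(x,z)\in L_2[\ell,+\infty)$. When $\dot A$ is non-negative, $m_\infty$ is holomorphic off $[0,+\infty)$, and $m_\infty(-0)=\lim_{x\to-0}m_\infty(x)$. The functions $-m_\infty$, $1/m_\infty$ and $-m_\alpha$ ($\alpha$ real) are Herglotz-Nevanlinna functions. Function classes. A scalar function $V$ is Herglotz-Nevanlinna if it is holomorphic on $\mathbb C\setminus\mathbb R$, satisfies $\overline{V(z)}=V(\bar z)$, and $\mathrm{Im}\,V(z)\ge0$ for $\mathrm{Im}\,z>0$. A Herglotz-Nevanlinna function $V$ is Stieltjes if it is holomorphic (extends holomorphically) in $\mathbb C\setminus[0,+\infty)$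 and $\mathrm{Im}[zV(z)]/\mathrm{Im}\,z\ge0$ for $\mathrm{Im}\,z\neq0$. It is inverse Stieltjes if it is holomorphic (extends holomorphically) in $\mathbb C\setminus[0,+\infty)$ and $\mathrm{Im}[V(z)/z]/\mathrm{Im}\,z\ge0$ for $\mathrm{Im}\,z\ne0$. *)

theory Defs
  imports "HOL-Analysis.Analysis" "HOL-Library.Function_Algebras"
begin

section \<open>The differential expression \<open>-y'' + q y\<close> on \<open>[l, \<infinity>)\<close>\<close>

text \<open>All functions on \<open>[l, \<infinity>)\<close> are total functions on the reals; only their values on
  \<open>{l..}\<close> matter.\<close>

definition locally_summable :: "real \<Rightarrow> (real \<Rightarrow> real) \<Rightarrow> bool" where
  "locally_summable l q \<longleftrightarrow> (\<forall>b. q absolutely_integrable_on {l..b})"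

definition square_integrable :: "real \<Rightarrow> (real \<Rightarrow> complex) \<Rightarrow> bool" where
  "square_integrable l f \<longleftrightarrow>
     f \<in> borel_measurable (lebesgue_on {l..}) \<and>
     integrable (lebesgue_on {l..}) (\<lambda>x. (cmod (f x))\<^sup>2)"

definition L2_inner :: "real \<Rightarrow> (real \<Rightarrow> complex) \<Rightarrow> (real \<Rightarrow> complex) \<Rightarrow> complex" where
  "L2_inner l f g = (LINT x|lebesgue_on {l..}. f x * cnj (g x))"

text \<open>\<open>f\<close> is locally absolutely continuous on \<open>[l, \<infinity>)\<close> and \<open>g\<close> is its almost everywhere
  derivative: \<open>f\<close> is the indefinite Lebesgue integral of a locally summable \<open>g\<close>.\<close>

definition loc_abs_cont :: "real \<Rightarrow> (real \<Rightarrow> complex) \<Rightarrow> (real \<Rightarrow> complex) \<Rightarrow> bool" where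
  "loc_abs_cont l f g \<longleftrightarrow>
     (\<forall>b\<ge>l. g absolutely_integrable_on {l..b} \<and> f b = f l + integral {l..b} g)"

text \<open>\<open>sl_expr l q y y' h\<close>: \<open>y\<close> and \<open>y'\<close> are locally absolutely continuous, \<open>y'\<close> is the derivative
  of \<open>y\<close> (one-sided at \<open>l\<close>), and \<open>-y'' + q y = h\<close> almost everywhere. Local absolute continuity of \<open>y\<close>
  need not be required separately, since \<open>y'\<close> is continuous.\<close>

definition sl_expr ::
  "real \<Rightarrow> (real \<Rightarrow> real) \<Rightarrow> (real \<Rightarrow> complex) \<Rightarrow> (real \<Rightarrow> complex) \<Rightarrow> (real \<Rightarrow> complex) \<Rightarrow> bool" where
  "sl_expr l q y y' h \<longleftrightarrow>
     (\<forall>x\<ge>l. (y has_vector_derivative y' x) (at x within {l..})) \<and>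
     (\<exists>y''. loc_abs_cont l y' y'' \<and>
        (AE x in lebesgue_on {l..}. h x = - y'' x + complex_of_real (q x) * y x))"

section \<open>The minimal operator, its adjoint and the deficiency indices\<close>

text \<open>Operators are given by their graphs.\<close>

definition adjoint_op :: "real \<Rightarrow> (real \<Rightarrow> real) \<Rightarrow> ((real \<Rightarrow> complex) \<times> (real \<Rightarrow> complex)) set" where
  "adjoint_op l q =
     {(y, h). square_integrable l y \<and> square_integrable l h \<and> (\<exists>y'. sl_expr l q y y' h)}"

definition minimal_op :: "real \<Rightarrow> (real \<Rightarrow> real) \<Rightarrow> ((real \<Rightarrow> complex) \<times> (real \<Rightarrow> complex)) set" where
  "minimal_op l q =
     {(y, h). square_integrable l y \<and> square_integrable l h \<and>
        (\<exists>y'. sl_expr l q y y' h \<and> y l = 0 \<and> y' l = 0)}"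

definition nonnegative_op :: "real \<Rightarrow> ((real \<Rightarrow> complex) \<times> (real \<Rightarrow> complex)) set \<Rightarrow> bool" where
  "nonnegative_op l A \<longleftrightarrow> (\<forall>(f, h)\<in>A. L2_inner l h f \<in> \<real>\<^sub>\<ge>\<^sub>0)"

text \<open>The kernel of the adjoint minus \<open>z\<close>. Functions are normalised to vanish to the left of \<open>l\<close>,
  so that equal elements of \<open>L\<^sub>2[l, \<infinity>)\<close> are represented by the same function (elements of the
  domain are continuous on \<open>{l..}\<close>).\<close>

definition deficiency_space :: "real \<Rightarrow> (real \<Rightarrow> real) \<Rightarrow> complex \<Rightarrow> (real \<Rightarrow> complex) set" where
  "deficiency_space l q z = {y. (\<forall>x<l. y x = 0) \<and> (y, \<lambda>x. z * y x) \<in> adjoint_op l q}"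

text \<open>Complex dimension of a set of functions (\<open>0\<close> if the dimension is infinite).\<close>

definition complex_fun_dim :: "(real \<Rightarrow> complex) set \<Rightarrow> nat" where
  "complex_fun_dim = vector_space.dim (\<lambda>(c::complex) (f::real \<Rightarrow> complex) x. c * f x)"

definition deficiency_indices :: "real \<Rightarrow> (real \<Rightarrow> real) \<Rightarrow> nat \<times> nat" where
  "deficiency_indices l q =
     (complex_fun_dim (deficiency_space l q \<i>), complex_fun_dim (deficiency_space l q (- \<i>)))"

section \<open>The Weyl-Titchmarsh functions\<close>

text \<open>The values of \<open>m\<close> on \<open>[0, \<infinity>)\<close> are irrelevant and left unspecified.\<close>

definition weyl_titchmarsh :: "real \<Rightarrow> (real \<Rightarrow> real) \<Rightarrow> (complex \<Rightarrow> complex) \<Rightarrow> bool" where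
  "weyl_titchmarsh l q m \<longleftrightarrow>
     (\<forall>z. z \<notin> \<real>\<^sub>\<ge>\<^sub>0 \<longrightarrow>
        (\<exists>\<phi>\<^sub>1 \<phi>\<^sub>1' \<phi>\<^sub>2 \<phi>\<^sub>2'.
           sl_expr l q \<phi>\<^sub>1 \<phi>\<^sub>1' (\<lambda>x. z * \<phi>\<^sub>1 x) \<and> \<phi>\<^sub>1 l = 0 \<and> \<phi>\<^sub>1' l = 1 \<and>
           sl_expr l q \<phi>\<^sub>2 \<phi>\<^sub>2' (\<lambda>x. z * \<phi>\<^sub>2 x) \<and> \<phi>\<^sub>2 l = -1 \<and> \<phi>\<^sub>2' l = 0 \<and>
           square_integrable l (\<lambda>x. \<phi>\<^sub>2 x + m z * \<phi>\<^sub>1 x)))"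

definition m_alpha :: "(complex \<Rightarrow> complex) \<Rightarrow> real \<Rightarrow> complex \<Rightarrow> complex" where
  "m_alpha m \<alpha> z =
     (complex_of_real (sin \<alpha>) + m z * complex_of_real (cos \<alpha>)) /
     (complex_of_real (cos \<alpha>) - m z * complex_of_real (sin \<alpha>))"

section \<open>Function classes\<close>

definition herglotz_nevanlinna :: "(complex \<Rightarrow> complex) \<Rightarrow> bool" where
  "herglotz_nevanlinna V \<longleftrightarrow>
     V holomorphic_on - \<real> \<and>
     (\<forall>z. z \<notin> \<real> \<longrightarrow> cnj (V z) = V (cnj z)) \<and>
     (\<forall>z. Im z > 0 \<longrightarrow> Im (V z) \<ge> 0)"

text \<open>A Herglotz-Nevanlinna function lives on the complement of the real axis; its (junk) values on
  the negative half-axis, such as \<open>1 / 0 = 0\<close> at a pole, play no role below.\<close>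

definition extends_off_nonneg :: "(complex \<Rightarrow> complex) \<Rightarrow> bool" where
  "extends_off_nonneg V \<longleftrightarrow>
     (\<exists>W. W holomorphic_on - \<real>\<^sub>\<ge>\<^sub>0 \<and> (\<forall>z. z \<notin> \<real> \<longrightarrow> W z = V z))"

definition stieltjes :: "(complex \<Rightarrow> complex) \<Rightarrow> bool" where
  "stieltjes V \<longleftrightarrow>
     herglotz_nevanlinna V \<and> extends_off_nonneg V \<and>
     (\<forall>z. Im z \<noteq> 0 \<longrightarrow> Im (z * V z) / Im z \<ge> 0)"

definition inverse_stieltjes :: "(complex \<Rightarrow> complex) \<Rightarrow> bool" where
  "inverse_stieltjes V \<longleftrightarrow>
     herglotz_nevanlinna V \<and> extends_off_nonneg V \<and>
     (\<forall>z. Im z \<noteq> 0 \<longrightarrow> Im (V z / z) / Im z \<ge> 0)"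

section \<open>Conventions for infinite values\<close>

definition ext_recip :: "real \<Rightarrow> ereal" where
  "ext_recip a = (if a = 0 then \<infinity> else ereal (1 / a))"

definition ext_tan :: "real \<Rightarrow> ereal" where
  "ext_tan \<alpha> = (if cos \<alpha> = 0 then \<infinity> else ereal (tan \<alpha>))"

end

theory Submission
  imports Defs
begin

text \<open>
  Write \<open>A\<close> for the minimal operator, \<open>\<psi> z = \<phi>\<^sub>2 + m z * \<phi>\<^sub>1\<close> for the Weyl solution, which has the boundary
  data \<open>\<psi> l = -1\<close> and \<open>\<psi>' l = m z\<close>, and \<open>N z\<close> for its squared norm.  The proof avoids integral
  representations of Stieltjes functions; everything follows from two inequalities for \<open>m\<close>, a lower bound and a growth estimate, drawn from
  the non-negativity of \<open>A\<close>.

  The operator part.  Solutions multiplied by a steep smooth cut-off near \<open>l\<close> give test functions with slope \<open>1\<close>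
  at \<open>l\<close> and vanishing energy (\<open>cutoff_bounds\<close>).  With them, non-negativity passes from \<open>A\<close> to its Dirichlet
  extension (\<open>dirichlet_nonneg\<close>).  Since \<open>(A f, f)\<close> is real, polarization shows that Green's identity on the
  domain of the adjoint has no boundary term at infinity (\<open>green_identity\<close>).  Applied to two Weyl solutions it
  reads \<open>(z - cnj w) (\<psi> z, \<psi> w) = cnj (m w) - m z\<close> (\<open>weyl_kernel\<close>).  This yields the symmetry of \<open>m\<close>,
  \<open>Im (m z) = - Im z * N z\<close>, and holomorphy, the latter because the Dirichlet operator is bounded away from
  every \<open>z\<close> off \<open>[0, \<infinity>)\<close>.  Non-negativity on \<open>\<psi> z - \<psi> x\<close>, with \<open>x\<close> increasing to \<open>0\<close>, gives the main inequality
  \<open>m\<^sub>0 \<le> Re z * N z + Re (m z)\<close> (\<open>m_lower_bound\<close>).  Testing with the cut-offs gives \<open>m x \<rightarrow> \<infinity>\<close> along a sequence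
  \<open>x \<rightarrow> -\<infinity>\<close> (\<open>m_unbounded\<close>).  In particular \<open>m\<close> takes on the negative half-axis exactly the values above \<open>m\<^sub>0\<close>.

  The function-theoretic part.  For nonreal \<open>z\<close> the quotient \<open>Im (z V z) / Im z\<close> of \<open>V = - m_alpha m \<alpha>\<close> is, up to a
  positive factor, \<open>Q \<alpha> (m z) + Re z * N z\<close> with a quadratic expression \<open>Q \<alpha>\<close> which for real \<open>v\<close> equals
  \<open>(v sin \<alpha> - cos \<alpha>) (v cos \<alpha> + sin \<alpha>)\<close>.  If \<open>V\<close> is Stieltjes, approaching the negative half-axis shows that
  this product is non-negative for all \<open>v > m\<^sub>0\<close>, which forces \<open>0 \<le> cot \<alpha> \<le> m\<^sub>0\<close>; conversely the main inequality
  gives non-negativity of the quotient under this condition.  The inverse Stieltjes case arises by a rotation of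
  \<open>\<alpha>\<close> through a right angle, and the functions \<open>1 / m\<close> and \<open>- m\<close> are the cases \<open>\<alpha> = \<pi> / 2\<close> and \<open>\<alpha> = 0\<close>.
\<close>

section \<open>The semi-inner product of \<open>L\<^sub>2[l, \<infinity>)\<close>\<close>

lemma borel_measurable_cnj:
  assumes "f \<in> borel_measurable M"
  shows "(\<lambda>x. cnj (f x)) \<in> borel_measurable M"
  using assms by (rule measurable_compose)
    (intro borel_measurable_continuous_onI continuous_intros)

lemma square_integrable_measurable:
  "square_integrable l f \<Longrightarrow> f \<in> borel_measurable (lebesgue_on {l..})"
  by (simp add: square_integrable_def)

lemma square_integrable_mult_cnj:
  assumes "square_integrable l f" "square_integrable l g"
  shows "integrable (lebesgue_on {l..}) (\<lambda>x. f x * cnj (g x))"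
proof (rule Bochner_Integration.integrable_bound)
  show "integrable (lebesgue_on {l..}) (\<lambda>x. (cmod (f x))\<^sup>2 + (cmod (g x))\<^sup>2)"
    using assms by (auto simp: square_integrable_def)
  show "(\<lambda>x. f x * cnj (g x)) \<in> borel_measurable (lebesgue_on {l..})"
    using assms by (intro borel_measurable_times borel_measurable_cnj square_integrable_measurable)
  show "AE x in lebesgue_on {l..}. norm (f x * cnj (g x)) \<le> norm ((cmod (f x))\<^sup>2 + (cmod (g x))\<^sup>2)"
  proof (rule AE_I2)
    fix x
    have "2 * (cmod (f x) * cmod (g x)) \<le> (cmod (f x))\<^sup>2 + (cmod (g x))\<^sup>2"
      using sum_squares_bound[of "cmod (f x)" "cmod (g x)"] by simp
    moreover have "0 \<le> cmod (f x) * cmod (g x)" by simp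
    ultimately have "cmod (f x) * cmod (g x) \<le> (cmod (f x))\<^sup>2 + (cmod (g x))\<^sup>2"
      by linarith
    then show "norm (f x * cnj (g x)) \<le> norm ((cmod (f x))\<^sup>2 + (cmod (g x))\<^sup>2)"
      by (simp add: norm_mult)
  qed
qed

lemma square_integrable_scale:
  assumes "square_integrable l f"
  shows "square_integrable l (\<lambda>x. c * f x)"
  using assms by (auto simp: square_integrable_def norm_mult power_mult_distrib)

lemma square_integrable_add:
  assumes f: "square_integrable l f" and g: "square_integrable l g"
  shows "square_integrable l (\<lambda>x. f x + g x)"
proof -
  have "(\<lambda>x. (cmod (f x + g x))\<^sup>2) =
      (\<lambda>x. (cmod (f x))\<^sup>2 + (cmod (g x))\<^sup>2 + 2 * Re (f x * cnj (g x)))"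
    unfolding cmod_power2 by (auto simp: power2_eq_square algebra_simps fun_eq_iff)
  moreover have "integrable (lebesgue_on {l..}) \<dots>"
    using f g square_integrable_mult_cnj[OF f g]
    by (intro Bochner_Integration.integrable_add integrable_mult_right integrable_Re)
       (auto simp: square_integrable_def)
  ultimately show ?thesis
    using f g by (auto simp: square_integrable_def)
qed

lemma L2_inner_add_left:
  assumes "square_integrable l f" "square_integrable l f'" "square_integrable l g"
  shows "L2_inner l (\<lambda>x. f x + c * f' x) g = L2_inner l f g + c * L2_inner l f' g"
proof -
  have "L2_inner l (\<lambda>x. f x + c * f' x) g
      = (LINT x|lebesgue_on {l..}. f x * cnj (g x) + c * (f' x * cnj (g x)))"
    unfolding L2_inner_def by (simp add: algebra_simps)
  also have "\<dots> = L2_inner l f g + c * L2_inner l f' g"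
    using assms by (simp add: L2_inner_def square_integrable_mult_cnj)
  finally show ?thesis .
qed

lemma L2_inner_cnj: "L2_inner l g f = cnj (L2_inner l f g)"
proof -
  have "(LINT x|lebesgue_on {l..}. g x * cnj (f x)) = (LINT x|lebesgue_on {l..}. cnj (f x * cnj (g x)))"
    by (simp add: mult.commute)
  then show ?thesis
    unfolding L2_inner_def by (simp only: Bochner_Integration.integral_cnj)
qed

lemma L2_inner_add_right:
  assumes "square_integrable l f" "square_integrable l f'" "square_integrable l g"
  shows "L2_inner l g (\<lambda>x. f x + c * f' x) = L2_inner l g f + cnj c * L2_inner l g f'"
  using L2_inner_add_left[OF assms, of c]
  by (metis L2_inner_cnj complex_cnj_add complex_cnj_mult)

text \<open>The square of the norm; working with squares avoids square roots in all the estimates.\<close>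

definition L2_sq :: "real \<Rightarrow> (real \<Rightarrow> complex) \<Rightarrow> real" where
  "L2_sq l f = (LINT x|lebesgue_on {l..}. (cmod (f x))\<^sup>2)"

lemma L2_inner_self: "L2_inner l f f = complex_of_real (L2_sq l f)"
proof -
  have "(\<lambda>x. f x * cnj (f x)) = (\<lambda>x. complex_of_real ((cmod (f x))\<^sup>2))"
    using complex_norm_square by (auto simp: fun_eq_iff)
  then show ?thesis
    unfolding L2_inner_def L2_sq_def by (simp only: integral_complex_of_real)
qed

lemma L2_sq_nonneg: "0 \<le> L2_sq l f"
  unfolding L2_sq_def by simp

lemma L2_Cauchy_Schwarz:
  assumes f: "square_integrable l f" and g: "square_integrable l g"
  shows "(cmod (L2_inner l f g))\<^sup>2 \<le> L2_sq l f * L2_sq l g"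
proof -
  define p where "p = L2_inner l f g"
  have key: "0 \<le> L2_sq l f - 2 * t * (cmod p)\<^sup>2 + t * t * (cmod p)\<^sup>2 * L2_sq l g" for t :: real
  proof -
    \<comment> \<open>The squared norm of \<open>f - t p g\<close>; the optimal \<open>t\<close> is inserted afterwards.\<close>
    let ?c = "- (complex_of_real t * p)"
    let ?h = "\<lambda>x. f x + ?c * g x"
    have h: "square_integrable l ?h"
      by (intro square_integrable_add square_integrable_scale f g)
    have "L2_inner l ?h ?h = L2_inner l f ?h + ?c * L2_inner l g ?h"
      using L2_inner_add_left[OF f g h] .
    also have "\<dots> = (L2_inner l f f + cnj ?c * p) + ?c * (cnj p + cnj ?c * L2_inner l g g)"
      using L2_inner_add_right[OF f g f, of ?c] L2_inner_add_right[OF f g g, of ?c]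
        L2_inner_cnj[of l g f] by (simp add: p_def)
    also have "\<dots> = complex_of_real
        (L2_sq l f - 2 * t * (cmod p)\<^sup>2 + t * t * (cmod p)\<^sup>2 * L2_sq l g)"
      using complex_norm_square[of p] by (simp add: L2_inner_self algebra_simps)
    finally have "L2_sq l ?h = L2_sq l f - 2 * t * (cmod p)\<^sup>2 + t * t * (cmod p)\<^sup>2 * L2_sq l g"
      unfolding L2_inner_self of_real_eq_iff .
    then show ?thesis using L2_sq_nonneg[of l ?h] by simp
  qed
  show ?thesis
  proof (cases "L2_sq l g = 0")
    case True
    have "p = 0"
    proof (rule ccontr)
      assume "p \<noteq> 0"
      then have "L2_sq l f - 2 * ((L2_sq l f + 1) / (cmod p)\<^sup>2) * (cmod p)\<^sup>2 = - L2_sq l f - 2"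
        by simp
      with key[of "(L2_sq l f + 1) / (cmod p)\<^sup>2"] True L2_sq_nonneg[of l f] show False
        by simp
    qed
    then show ?thesis by (simp add: p_def L2_sq_nonneg True)
  next
    case False
    then have pos: "L2_sq l g > 0" using L2_sq_nonneg[of l g] by simp
    have "0 \<le> L2_sq l f - (cmod p)\<^sup>2 / L2_sq l g"
      using key[of "1 / L2_sq l g"] pos by (simp add: field_simps)
    then show ?thesis using pos by (simp add: p_def field_simps)
  qed
qed

text \<open>The only source of norm estimates: the cut-offs below live on an interval of length \<open>1 / n\<close>,
  so that their size follows from uniform bounds.\<close>

lemma L2_sq_bounded_support:
  assumes ab: "l \<le> b" and meas: "f \<in> borel_measurable (lebesgue_on {l..})"
    and bnd: "\<And>x. x \<in> {l..b} \<Longrightarrow> cmod (f x) \<le> B" and supp: "\<And>x. b < x \<Longrightarrow> f x = 0"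
  shows "square_integrable l f" "L2_sq l f \<le> B\<^sup>2 * (b - l)"
proof -
  let ?I = "\<lambda>x. B\<^sup>2 * indicat_real {l..b} x"
  have int: "integrable (lebesgue_on {l..}) ?I"
    by (intro integrable_mult_right integrable_real_indicator)
      (auto simp: sets_restrict_space_iff emeasure_restrict_space Int_absorb2 emeasure_lborel_Icc_eq)
  have le: "(cmod (f x))\<^sup>2 \<le> ?I x" if "x \<in> {l..}" for x
    using bnd[of x] supp[of x] that by (cases "x \<le> b") (auto intro!: power_mono)
  have sq: "integrable (lebesgue_on {l..}) (\<lambda>x. (cmod (f x))\<^sup>2)"
    using int by (rule Bochner_Integration.integrable_bound) (use meas le in auto)
  then show "square_integrable l f"
    using meas by (simp add: square_integrable_def)
  have "L2_sq l f \<le> (LINT x|lebesgue_on {l..}. ?I x)"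
    unfolding L2_sq_def using sq int le by (intro integral_mono) auto
  also have "\<dots> = B\<^sup>2 * (b - l)"
    using ab by (simp add: measure_restrict_space Int_absorb2)
  finally show "L2_sq l f \<le> B\<^sup>2 * (b - l)" .
qed

section \<open>Products of locally absolutely continuous functions\<close>

lemma loc_abs_contD:
  assumes "loc_abs_cont l G g" "l \<le> b"
  shows "g absolutely_integrable_on {l..b}" "G b = G l + integral {l..b} g"
  using assms unfolding loc_abs_cont_def by blast+

lemma loc_abs_cont_integral:
  assumes "loc_abs_cont l G g" "l \<le> x" "x \<le> y"
  shows "g absolutely_integrable_on {x..y}" "G y - G x = integral {x..y} g"
proof -
  have y: "g absolutely_integrable_on {l..y}" and Gy: "G y = G l + integral {l..y} g"
    and Gx: "G x = G l + integral {l..x} g"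
    using loc_abs_contD[OF assms(1)] assms(2,3) order_trans by blast+
  show "g absolutely_integrable_on {x..y}"
    using y by (rule absolutely_integrable_on_subinterval[where a = x and b = y, simplified])
      (use assms in auto)
  have "integral {l..x} g + integral {x..y} g = integral {l..y} g"
    using assms y by (intro Henstock_Kurzweil_Integration.integral_combine) (auto simp: absolutely_integrable_on_def)
  then show "G y - G x = integral {x..y} g"
    by (simp add: Gx Gy algebra_simps)
qed

lemma loc_abs_cont_continuous:
  assumes "loc_abs_cont l G g"
  shows "continuous_on {l..b} G"
proof (cases "l \<le> b")
  case True
  then have "g integrable_on {l..b}"
    using loc_abs_contD(1)[OF assms] by (simp add: absolutely_integrable_on_def)
  then have "continuous_on {l..b} (\<lambda>x. G l + integral {l..x} g)"
    by (intro continuous_intros indefinite_integral_continuous_1)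
  then show ?thesis
    by (rule continuous_on_eq) (simp flip: loc_abs_contD(2)[OF assms])
qed auto

lemma loc_abs_cont_add:
  assumes "loc_abs_cont l F f" "loc_abs_cont l G g"
  shows "loc_abs_cont l (\<lambda>x. F x + c * G x) (\<lambda>x. f x + c * g x)"
  unfolding loc_abs_cont_def
proof (intro allI impI conjI)
  fix b assume b: "l \<le> b"
  have f: "f absolutely_integrable_on {l..b}" "F b = F l + integral {l..b} f"
    and g: "g absolutely_integrable_on {l..b}" "G b = G l + integral {l..b} g"
    using assms[THEN loc_abs_contD(1), OF b] assms[THEN loc_abs_contD(2), OF b] by blast+
  have cg: "(\<lambda>x. c * g x) absolutely_integrable_on {l..b}"
    using absolutely_integrable_linear[OF g(1) bounded_linear_mult_right[of c]]
    by (simp add: o_def)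
  show "(\<lambda>x. f x + c * g x) absolutely_integrable_on {l..b}"
    using f(1) cg by (rule set_integral_add)
  show "F b + c * G b = F l + c * G l + integral {l..b} (\<lambda>x. f x + c * g x)"
    using f(1) cg
    by (subst Henstock_Kurzweil_Integration.integral_add)
       (auto simp: absolutely_integrable_on_def algebra_simps f(2) g(2))
qed

lemma loc_abs_cont_cnj:
  assumes "loc_abs_cont l F f"
  shows "loc_abs_cont l (\<lambda>x. cnj (F x)) (\<lambda>x. cnj (f x))"
  unfolding loc_abs_cont_def
proof (intro allI impI conjI)
  fix b assume b: "l \<le> b"
  have f: "f absolutely_integrable_on {l..b}" "F b = F l + integral {l..b} f"
    using loc_abs_contD[OF assms b] by blast+
  show "(\<lambda>x. cnj (f x)) absolutely_integrable_on {l..b}"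
    using absolutely_integrable_linear[OF f(1) bounded_linear_cnj] by (simp add: o_def)
  show "cnj (F b) = cnj (F l) + integral {l..b} (\<lambda>x. cnj (f x))"
    by (simp add: f(2) flip: Henstock_Kurzweil_Integration.integral_cnj)
qed

text \<open>Differentiability almost everywhere of an indefinite Lebesgue integral can be bypassed.  Put
  \<open>\<Phi> x = integral {l..x} (F' G + F g) - F x * G x\<close> and \<open>N x = integral {l..x} |g|\<close>.  Both \<open>F t - F x\<close> and
  \<open>G t - G y\<close> are small for \<open>t \<in> {x..y}\<close>, which gives \<open>|\<Phi> y - \<Phi> x| \<le> 2 C (y - x) (N y - N x)\<close>.  As \<open>N\<close> is
  continuous, \<open>\<Phi>\<close> has derivative \<open>0\<close> at every point, and hence it is constant.\<close>

lemma loc_abs_cont_mult: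
  assumes F: "\<And>x. l \<le> x \<Longrightarrow> (F has_vector_derivative F' x) (at x within {l..})"
    and F': "continuous_on {l..} F'"
    and G: "loc_abs_cont l G g"
  shows "loc_abs_cont l (\<lambda>x. F x * G x) (\<lambda>x. F' x * G x + F x * g x)"
  unfolding loc_abs_cont_def
proof (intro allI impI)
  fix b assume lb: "l \<le> b"
  let ?D = "\<lambda>x. F' x * G x + F x * g x"
  have contF: "continuous_on {l..b} F"
    by (rule continuous_on_subset[of "{l..}"])
       (auto simp: continuous_on_eq_continuous_within intro!: has_vector_derivative_continuous F)
  have contF': "continuous_on {l..b} F'"
    using F' by (rule continuous_on_subset) auto
  have contG: "continuous_on {l..b} G"
    using G by (rule loc_abs_cont_continuous)
  have g: "g absolutely_integrable_on {l..b}"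
    using loc_abs_cont_integral(1)[OF G _ lb] by simp
  have Fg: "(\<lambda>x. F x * g x) absolutely_integrable_on {l..b}"
  proof (rule absolutely_integrable_bounded_measurable_product[where h = "(*)"])
    show "bilinear ((*) :: complex \<Rightarrow> complex \<Rightarrow> complex)"
      by (rule bilinear_times)
    show "F \<in> borel_measurable (lebesgue_on {l..b})"
      using contF by (rule continuous_imp_measurable_on_sets_lebesgue) simp
    show "bounded (F ` {l..b})"
      by (intro compact_imp_bounded compact_continuous_image contF) simp
  qed (use g in auto)
  have D: "?D absolutely_integrable_on {l..b}"
    by (intro set_integral_add Fg absolutely_integrable_continuous_real
        continuous_intros contF' contG)
  obtain C where C: "C \<ge> 0" "\<And>x. x \<in> {l..b} \<Longrightarrow> cmod (F' x) \<le> C"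
  proof -
    have "bounded (F' ` {l..b})"
      by (intro compact_imp_bounded compact_continuous_image contF') simp
    then obtain C where C: "\<forall>x\<in>{l..b}. cmod (F' x) \<le> C"
      unfolding bounded_iff by auto
    show ?thesis
      by (rule that[of "max C 0"]) (use C in \<open>auto simp: le_max_iff_disj\<close>)
  qed
  define N where "N = (\<lambda>x. integral {l..x} (\<lambda>t. cmod (g t)))"
  have intN: "(\<lambda>t. cmod (g t)) integrable_on {l..b}"
    using g by (simp add: absolutely_integrable_on_def)
  have contN: "continuous_on {l..b} N"
    unfolding N_def using intN by (rule indefinite_integral_continuous_1)
  define \<Phi> where "\<Phi> = (\<lambda>x. integral {l..x} ?D - F x * G x)"
  have main: "cmod (\<Phi> y - \<Phi> x) \<le> 2 * C * (y - x) * (N y - N x)"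
    if xy: "l \<le> x" "x \<le> y" "y \<le> b" for x y
  proof -
    have sub: "{x..y} \<subseteq> {l..b}" using xy by auto
    have Nxy: "integral {s..t} (\<lambda>t. cmod (g t)) = N t - N s" if "x \<le> s" "s \<le> t" "t \<le> y" for s t
      unfolding N_def
      using Henstock_Kurzweil_Integration.integral_combine[of l s t "\<lambda>t. cmod (g t)"] that xy
        integrable_on_subinterval[OF intN, of l t]
      by (simp add: algebra_simps)
    have Nmono: "N s \<le> N t" if "x \<le> s" "s \<le> t" "t \<le> y" for s t
    proof -
      have "0 \<le> integral {s..t} (\<lambda>t. cmod (g t))"
        using integrable_on_subinterval[OF intN, of s t] that xy
        by (intro Henstock_Kurzweil_Integration.integral_nonneg) auto
      then show ?thesis using Nxy[OF that] by simp
    qed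
    have FTC: "(F' has_integral (F t - F x)) {x..t}" if "t \<in> {x..y}" for t
      by (rule fundamental_theorem_of_calculus)
        (use that xy in \<open>auto intro!: has_vector_derivative_within_subset[OF F]\<close>)
    have Fdiff: "cmod (F t - F x) \<le> C * (y - x)" if "t \<in> {x..y}" for t
    proof -
      have "cmod (F t - F x) \<le> C * (t - x)"
        using has_integral_bound_real[OF C(1) finite.emptyI FTC[OF that]] C(2) that sub by auto
      also have "\<dots> \<le> C * (y - x)"
        using that C(1) by (intro mult_left_mono) auto
      finally show ?thesis .
    qed
    have Gdiff: "cmod (G t - G y) \<le> N y - N x" if "t \<in> {x..y}" for t
    proof -
      have "cmod (G t - G y) = cmod (integral {t..y} g)"
        using loc_abs_cont_integral(2)[OF G, of t y] that xy
          norm_minus_commute[of "G t" "G y"] by auto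
      also have "\<dots> \<le> integral {t..y} (\<lambda>t. cmod (g t))"
        using loc_abs_cont_integral(1)[OF G, of t y] that xy
        by (intro Henstock_Kurzweil_Integration.integral_norm_bound_integral)
           (auto simp: absolutely_integrable_on_def)
      also have "\<dots> = N y - N t"
        using that by (intro Nxy) auto
      also have "\<dots> \<le> N y - N x"
        using Nmono[of x t] that by simp
      finally show ?thesis .
    qed
    have "integral {l..x} ?D + integral {x..y} ?D = integral {l..y} ?D"
      using D xy
      by (intro Henstock_Kurzweil_Integration.integral_combine)
         (auto simp: absolutely_integrable_on_def intro: integrable_on_subinterval)
    then have \<Phi>: "\<Phi> y - \<Phi> x = integral {x..y} ?D - F x * (G y - G x) - G y * (F y - F x)"
      by (simp add: \<Phi>_def algebra_simps)
    have "(g has_integral (G y - G x)) {x..y}"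
      using loc_abs_cont_integral[OF G, of x y] xy
      by (simp add: absolutely_integrable_on_def integrable_integral)
    then have 1: "((\<lambda>t. F x * g t) has_integral (F x * (G y - G x))) {x..y}"
      by (rule has_integral_mult_right)
    have 2: "((\<lambda>t. G y * F' t) has_integral (G y * (F y - F x))) {x..y}"
      using FTC[of y] xy by (intro has_integral_mult_right) auto
    have "(?D has_integral integral {x..y} ?D) {x..y}"
      using D sub xy
      by (auto simp: absolutely_integrable_on_def intro!: integrable_integral intro: integrable_on_subinterval)
    from has_integral_diff[OF has_integral_diff[OF this 1] 2]
    have I: "((\<lambda>t. (F t - F x) * g t + (G t - G y) * F' t) has_integral (\<Phi> y - \<Phi> x)) {x..y}"
      unfolding \<Phi> by (simp add: algebra_simps)
    let ?b = "\<lambda>t. C * (y - x) * cmod (g t) + (N y - N x) * C"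
    have J: "(?b has_integral (C * (y - x) * (N y - N x) + (y - x) * ((N y - N x) * C))) {x..y}"
    proof (intro has_integral_add has_integral_mult_right)
      show "((\<lambda>t. cmod (g t)) has_integral (N y - N x)) {x..y}"
        using Nxy[of x y] xy integrable_integral[OF integrable_on_subinterval[OF intN sub]]
        by simp
      show "((\<lambda>t. (N y - N x) * C) has_integral (y - x) * ((N y - N x) * C)) {x..y}"
        using has_integral_const_real[of "(N y - N x) * C" x y] xy by simp
    qed
    have "cmod (\<Phi> y - \<Phi> x) \<le> C * (y - x) * (N y - N x) + (y - x) * ((N y - N x) * C)"
    proof -
      have le: "cmod ((F t - F x) * g t + (G t - G y) * F' t) \<le> ?b t" if "t \<in> {x..y}" for t
      proof -
        have "cmod ((F t - F x) * g t) \<le> C * (y - x) * cmod (g t)"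
          using Fdiff[OF that] by (simp add: norm_mult mult_right_mono)
        moreover have "cmod ((G t - G y) * F' t) \<le> (N y - N x) * C"
          unfolding norm_mult using Gdiff[OF that] C that sub Nmono[of x y] xy
          by (intro mult_mono) auto
        ultimately show ?thesis using norm_triangle_mono by blast
      qed
      show ?thesis
        using Henstock_Kurzweil_Integration.integral_norm_bound_integral
            [OF has_integral_integrable[OF I] has_integral_integrable[OF J] le]
        by (simp only: integral_unique[OF I] integral_unique[OF J])
    qed
    then show ?thesis by (simp add: algebra_simps)
  qed
  have "\<exists>c. \<forall>x\<in>{l..b}. \<Phi> x = c"
  proof (rule has_derivative_zero_constant)
    fix x assume x: "x \<in> {l..b}"
    show "(\<Phi> has_derivative (\<lambda>h. 0)) (at x within {l..b})"
      unfolding has_derivative_within_alt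
    proof (intro conjI allI impI)
      fix e :: real assume e: "e > 0"
      then have "e / (2 * C + 1) > 0" using C(1) by simp
      then obtain d where d: "d > 0"
        "\<And>y. y \<in> {l..b} \<Longrightarrow> dist y x < d \<Longrightarrow> dist (N y) (N x) < e / (2 * C + 1)"
        using contN x unfolding continuous_on_iff by metis
      show "\<exists>d>0. \<forall>y\<in>{l..b}. norm (y - x) < d \<longrightarrow> norm (\<Phi> y - \<Phi> x - 0) \<le> e * norm (y - x)"
      proof (intro exI[of _ d] conjI ballI impI)
        fix y assume y: "y \<in> {l..b}" "norm (y - x) < d"
        have "cmod (\<Phi> y - \<Phi> x) \<le> 2 * C * \<bar>y - x\<bar> * \<bar>N y - N x\<bar>"
        proof (cases "x \<le> y")
          case True
          then have "cmod (\<Phi> y - \<Phi> x) \<le> 2 * C * (y - x) * (N y - N x)"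
            using main[of x y] x y by auto
          also have "\<dots> \<le> 2 * C * (y - x) * \<bar>N y - N x\<bar>"
            using True C(1) by (intro mult_left_mono) auto
          finally show ?thesis using True by simp
        next
          case False
          then have "cmod (\<Phi> x - \<Phi> y) \<le> 2 * C * (x - y) * (N x - N y)"
            using main[of y x] x y by auto
          also have "\<dots> \<le> 2 * C * (x - y) * \<bar>N y - N x\<bar>"
            using False C(1) by (intro mult_left_mono) auto
          finally show ?thesis using False by (simp add: norm_minus_commute)
        qed
        also have "\<dots> \<le> 2 * C * \<bar>y - x\<bar> * (e / (2 * C + 1))"
          using d(2)[of y] y C(1) by (intro mult_left_mono) (auto simp: dist_norm)
        also have "\<dots> = (2 * C / (2 * C + 1)) * (e * \<bar>y - x\<bar>)"
          by simp
        also have "\<dots> \<le> 1 * (e * \<bar>y - x\<bar>)"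
          using C(1) e by (intro mult_right_mono) auto
        finally show "norm (\<Phi> y - \<Phi> x - 0) \<le> e * norm (y - x)" by simp
      qed (use d in auto)
    qed simp
  qed simp
  then have "\<Phi> b = \<Phi> l" using lb by auto
  then show "?D absolutely_integrable_on {l..b} \<and> F b * G b = F l * G l + integral {l..b} ?D"
    using D by (simp add: \<Phi>_def algebra_simps)
qed

section \<open>Green's identity for compactly supported functions\<close>

text \<open>Membership in the domain of the adjoint, with the derivative \<open>y'\<close> exposed because the boundary data
  \<open>y l\<close> and \<open>y' l\<close> enter every identity.\<close>

definition in_max_domain where
  "in_max_domain l q y y' h \<longleftrightarrow>
     square_integrable l y \<and> square_integrable l h \<and> sl_expr l q y y' h"

lemma sl_expr_add:
  assumes "sl_expr l q y y' h" "sl_expr l q u u' k"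
  shows "sl_expr l q (\<lambda>x. y x + c * u x) (\<lambda>x. y' x + c * u' x) (\<lambda>x. h x + c * k x)"
proof -
  obtain y'' u'' where y: "\<forall>x\<ge>l. (y has_vector_derivative y' x) (at x within {l..})"
      "loc_abs_cont l y' y''" "AE x in lebesgue_on {l..}. h x = - y'' x + complex_of_real (q x) * y x"
    and u: "\<forall>x\<ge>l. (u has_vector_derivative u' x) (at x within {l..})"
      "loc_abs_cont l u' u''" "AE x in lebesgue_on {l..}. k x = - u'' x + complex_of_real (q x) * u x"
    using assms unfolding sl_expr_def by blast
  have "AE x in lebesgue_on {l..}. h x + c * k x =
      - (y'' x + c * u'' x) + complex_of_real (q x) * (y x + c * u x)"
    using y(3) u(3)
  proof eventually_elim
    case (elim x)
    show ?case unfolding elim by (simp add: algebra_simps)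
  qed
  moreover have "\<forall>x\<ge>l. ((\<lambda>x. y x + c * u x) has_vector_derivative y' x + c * u' x) (at x within {l..})"
    using y(1) u(1) by (auto intro!: has_vector_derivative_add has_vector_derivative_mult_right)
  ultimately show ?thesis
    unfolding sl_expr_def using loc_abs_cont_add[OF y(2) u(2)] by blast
qed

lemma in_max_domain_add:
  assumes "in_max_domain l q y y' h" "in_max_domain l q u u' k"
  shows "in_max_domain l q (\<lambda>x. y x + c * u x) (\<lambda>x. y' x + c * u' x) (\<lambda>x. h x + c * k x)"
  using assms unfolding in_max_domain_def
  by (auto intro: square_integrable_add square_integrable_scale sl_expr_add)

lemma sl_expr_continuous:
  assumes "sl_expr l q y y' h"
  shows "continuous_on {l..} y" "continuous_on {l..} y'"
proof -
  show "continuous_on {l..} y"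
    using assms unfolding sl_expr_def
    by (auto simp: continuous_on_eq_continuous_within intro!: has_vector_derivative_continuous)
  obtain y'' where y'': "loc_abs_cont l y' y''"
    using assms unfolding sl_expr_def by blast
  show "continuous_on {l..} y'"
    unfolding continuous_on_eq_continuous_within
  proof
    fix x assume x: "x \<in> {l..}"
    have "continuous (at x within {l..x + 1}) y'"
      using loc_abs_cont_continuous[OF y'', of "x + 1"] x
      by (auto simp: continuous_on_eq_continuous_within)
    moreover have "at x within {l..x + 1} = at x within {l..}"
      using x by (intro at_within_nhd[of x "{..<x + 1}"]) auto
    ultimately show "continuous (at x within {l..}) y'"
      by (simp add: continuous_within)
  qed
qed

lemma AE_lebesgue_on_negligible:
  assumes "AE x in lebesgue_on S. P x" "S \<in> sets lebesgue"
  shows "\<exists>N. negligible N \<and> (\<forall>x\<in>S - N. P x)"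
proof -
  have "AE x in lebesgue. x \<in> S \<longrightarrow> P x"
    using assms by (subst (asm) AE_restrict_space_iff) auto
  then show ?thesis
    unfolding eventually_ae_filter_negligible by blast
qed

text \<open>The Wronskian-type function \<open>W = f * cnj g' - cnj g * f'\<close> is locally absolutely continuous, and
  the potential cancels in its derivative \<open>f * cnj g'' - cnj g * f''\<close>; the upper boundary term
  vanishes with \<open>g\<close>.\<close>

lemma green_identity_compact:
  assumes f: "in_max_domain l q f f' h" and g: "in_max_domain l q g g' k"
    and b: "l \<le> b" and supp: "\<And>x. b \<le> x \<Longrightarrow> g x = 0 \<and> g' x = 0 \<and> k x = 0"
  shows "L2_inner l h g - L2_inner l f k = f' l * cnj (g l) - f l * cnj (g' l)"
proof -
  have f_sl: "sl_expr l q f f' h" and g_sl: "sl_expr l q g g' k"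
    using f g by (auto simp: in_max_domain_def)
  obtain f'' g'' where f': "\<forall>x\<ge>l. (f has_vector_derivative f' x) (at x within {l..})"
    and f'': "loc_abs_cont l f' f''"
    and f_ae: "AE x in lebesgue_on {l..}. h x = - f'' x + complex_of_real (q x) * f x"
    and g': "\<forall>x\<ge>l. (g has_vector_derivative g' x) (at x within {l..})"
    and g'': "loc_abs_cont l g' g''"
    and g_ae: "AE x in lebesgue_on {l..}. k x = - g'' x + complex_of_real (q x) * g x"
    using f_sl g_sl unfolding sl_expr_def by blast
  have S: "{l..} \<in> sets lebesgue" by simp
  define u where "u = (\<lambda>x. h x * cnj (g x) - f x * cnj (k x))"
  define D where "D = (\<lambda>x. (f' x * cnj (g' x) + f x * cnj (g'' x)) +
      (- 1) * (cnj (g' x) * f' x + cnj (g x) * f'' x))"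
  define W where "W = (\<lambda>x. f x * cnj (g' x) + (- 1) * (cnj (g x) * f' x))"
  have "loc_abs_cont l (\<lambda>x. f x * cnj (g' x)) (\<lambda>x. f' x * cnj (g' x) + f x * cnj (g'' x))"
    using f' sl_expr_continuous(2)[OF f_sl] loc_abs_cont_cnj[OF g'']
    by (intro loc_abs_cont_mult) auto
  moreover have "loc_abs_cont l (\<lambda>x. cnj (g x) * f' x) (\<lambda>x. cnj (g' x) * f' x + cnj (g x) * f'' x)"
    using g' sl_expr_continuous(2)[OF g_sl] f''
    by (intro loc_abs_cont_mult) (auto intro!: has_vector_derivative_cnj continuous_intros)
  ultimately have W: "loc_abs_cont l W D"
    unfolding W_def D_def by (rule loc_abs_cont_add)
  have ae: "AE x in lebesgue_on {l..}. u x = D x"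
    using f_ae g_ae
  proof eventually_elim
    case (elim x)
    show ?case unfolding u_def D_def elim by (simp add: algebra_simps)
  qed
  obtain N where N: "negligible N" "\<forall>x\<in>{l..} - N. u x = D x"
    using AE_lebesgue_on_negligible[OF ae S] by auto
  have "(D has_integral (W b - W l)) {l..b}"
    using loc_abs_cont_integral[OF W _ b]
    by (metis absolutely_integrable_on_def integrable_integral order_refl)
  then have "(u has_integral (W b - W l)) {l..b}"
    by (rule has_integral_spike[OF N(1), rotated]) (rule N(2)[rule_format], simp)
  then have "((\<lambda>x. if x \<in> {l..b} then u x else 0) has_integral (W b - W l)) {l..}"
    by (subst has_integral_restrict) auto
  then have "(u has_integral (W b - W l)) {l..}"
    by (rule has_integral_eq[rotated]) (use supp in \<open>auto simp: u_def\<close>)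
  then have "integral {l..} u = f' l * cnj (g l) - f l * cnj (g' l)"
    using supp[of b] by (simp add: integral_unique W_def)
  moreover have int: "integrable (lebesgue_on {l..}) (\<lambda>x. h x * cnj (g x))"
      "integrable (lebesgue_on {l..}) (\<lambda>x. f x * cnj (k x))"
    using f g by (auto simp: in_max_domain_def intro!: square_integrable_mult_cnj)
  then have "integral\<^sup>L (lebesgue_on {l..}) u = integral {l..} u"
    unfolding u_def by (intro lebesgue_integral_eq_integral Bochner_Integration.integrable_diff) auto
  moreover have "integral\<^sup>L (lebesgue_on {l..}) u = L2_inner l h g - L2_inner l f k"
    unfolding L2_inner_def u_def using int by (rule Bochner_Integration.integral_diff)
  ultimately show ?thesis by simp
qed

section \<open>Cut-off solutions\<close>

lemma DERIV_max_0_power: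
  "((\<lambda>x. max 0 x ^ Suc (Suc m)) has_real_derivative (real (Suc (Suc m)) * max 0 x ^ Suc m)) (at x)"
proof -
  consider "x > 0" | "x < 0" | "x = 0" by linarith
  then show ?thesis
  proof cases
    case 1
    have "((\<lambda>x. x ^ Suc (Suc m)) has_real_derivative (real (Suc (Suc m)) * x ^ Suc m)) (at x)"
      by (rule DERIV_pow[THEN DERIV_cong]) simp
    then have "((\<lambda>x. max 0 x ^ Suc (Suc m)) has_real_derivative (real (Suc (Suc m)) * x ^ Suc m)) (at x)"
      by (rule has_field_derivative_transform_within_open[of _ _ _ "{0<..}"]) (use 1 in auto)
    then show ?thesis using 1 by (simp add: max_def)
  next
    case 2
    have "((\<lambda>x. 0) has_real_derivative 0) (at x)"
      by simp
    then have "((\<lambda>x. max 0 x ^ Suc (Suc m)) has_real_derivative 0) (at x)"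
      by (rule has_field_derivative_transform_within_open[of _ _ _ "{..<0}"]) (use 2 in auto)
    then show ?thesis using 2 by (simp add: max_def)
  next
    case 3
    have "((\<lambda>h::real. max 0 h ^ Suc (Suc m) / h) \<longlongrightarrow> 0) (at 0)"
    proof (rule Lim_null_comparison)
      show "\<forall>\<^sub>F h in at 0. norm (max 0 h ^ Suc (Suc m) / h) \<le> \<bar>h\<bar> ^ Suc m"
      proof (intro always_eventually allI)
        fix h :: real
        show "norm (max 0 h ^ Suc (Suc m) / h) \<le> \<bar>h\<bar> ^ Suc m"
        proof (cases "h > 0")
          case True
          then show ?thesis by simp
        next
          case False
          then have "norm (max 0 h ^ Suc (Suc m) / h) = 0" by simp
          also have "0 \<le> \<bar>h\<bar> ^ Suc m" by (rule zero_le_power) simp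
          finally show ?thesis .
        qed
      qed
      show "((\<lambda>h::real. \<bar>h\<bar> ^ Suc m) \<longlongrightarrow> 0) (at 0)"
        by (rule tendsto_eq_intros refl | simp)+
    qed
    then show ?thesis using 3 by (simp add: DERIV_def)
  qed
qed

text \<open>The cube of this function is a twice continuously differentiable cut-off that equals \<open>1\<close> at \<open>l\<close> and
  vanishes from \<open>l + 1 / n\<close> on.\<close>

definition ramp :: "real \<Rightarrow> real \<Rightarrow> real \<Rightarrow> real" where
  "ramp l n x = max 0 (1 - n * (x - l))"

lemma DERIV_ramp_power:
  assumes "2 \<le> k"
  shows "((\<lambda>x. complex_of_real (ramp l n x ^ k)) has_vector_derivative
     complex_of_real (- (n * (real k * ramp l n x ^ (k - 1))))) (at x within S)"
proof -
  obtain m where "k = 2 + m"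
    using le_Suc_ex[OF assms] by blast
  then have k: "k = Suc (Suc m)" by simp
  have "((\<lambda>x. 1 - n * (x - l)) has_real_derivative - n) (at x within S)"
    by (auto intro!: derivative_eq_intros)
  from DERIV_chain2[OF DERIV_max_0_power this, of m]
  have "((\<lambda>x. ramp l n x ^ k) has_real_derivative
      - (n * (real k * ramp l n x ^ (k - 1)))) (at x within S)"
    by (simp add: ramp_def algebra_simps k)
  then show ?thesis
    by (rule has_vector_derivative_of_real)
qed

lemma continuous_on_ramp: "continuous_on S (ramp l n)"
  unfolding ramp_def by (intro continuous_intros)

lemma ramp_support: "n > 0 \<Longrightarrow> l + 1 / n \<le> x \<Longrightarrow> ramp l n x = 0"
  by (auto simp: ramp_def field_simps max_def)

lemma ramp_nonneg: "0 \<le> ramp l n x"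
  by (simp add: ramp_def)

lemma ramp_le_1: "n \<ge> 0 \<Longrightarrow> l \<le> x \<Longrightarrow> ramp l n x \<le> 1"
  by (simp add: ramp_def)

lemma ramp_start: "ramp l n l = 1"
  by (simp add: ramp_def)

text \<open>Multiplying a solution of \<open>-y'' + q y = z y\<close> by a smooth cut-off \<open>\<chi>\<close> stays inside the domain of the
  adjoint although \<open>q\<close> is merely locally summable: \<open>q\<close> enters the image
  \<open>z \<chi> y - \<chi>'' y - 2 \<chi>' y'\<close> only through \<open>z y\<close>, and that image is continuous.\<close>

definition cutoff :: "real \<Rightarrow> real \<Rightarrow> (real \<Rightarrow> complex) \<Rightarrow> real \<Rightarrow> complex" where
  "cutoff l n y x = complex_of_real (ramp l n x ^ 3) * y x"

definition cutoff_deriv ::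
  "real \<Rightarrow> real \<Rightarrow> (real \<Rightarrow> complex) \<Rightarrow> (real \<Rightarrow> complex) \<Rightarrow> real \<Rightarrow> complex" where
  "cutoff_deriv l n y y' x =
     complex_of_real (- (3 * n * ramp l n x ^ 2)) * y x + complex_of_real (ramp l n x ^ 3) * y' x"

definition cutoff_image ::
  "complex \<Rightarrow> real \<Rightarrow> real \<Rightarrow> (real \<Rightarrow> complex) \<Rightarrow> (real \<Rightarrow> complex) \<Rightarrow> real \<Rightarrow> complex" where
  "cutoff_image z l n y y' x =
     z * (complex_of_real (ramp l n x ^ 3) * y x)
     - complex_of_real (6 * n\<^sup>2 * ramp l n x) * y x
     + complex_of_real (6 * n * ramp l n x ^ 2) * y' x"

lemma cutoff_support:
  assumes "n > 0" "l + 1 / n \<le> x"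
  shows "cutoff l n y x = 0" "cutoff_deriv l n y y' x = 0" "cutoff_image z l n y y' x = 0"
  using ramp_support[OF assms] by (auto simp: cutoff_def cutoff_deriv_def cutoff_image_def)

lemma loc_abs_cont_C1:
  assumes F: "\<And>x. l \<le> x \<Longrightarrow> (F has_vector_derivative F' x) (at x within {l..})"
    and F': "continuous_on {l..} F'"
  shows "loc_abs_cont l F F'"
proof -
  have "loc_abs_cont l (\<lambda>x. 1) (\<lambda>x. 0)"
    by (simp add: loc_abs_cont_def absolutely_integrable_on_def)
  from loc_abs_cont_mult[OF F F' this] show ?thesis by simp
qed

lemma cutoff_sl_expr:
  assumes y: "sl_expr l q y y' (\<lambda>x. z * y x)"
  shows "sl_expr l q (cutoff l n y) (cutoff_deriv l n y y') (cutoff_image z l n y y')"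
proof -
  obtain y'' where y': "\<forall>x\<ge>l. (y has_vector_derivative y' x) (at x within {l..})"
    and y'': "loc_abs_cont l y' y''"
    and ae: "AE x in lebesgue_on {l..}. z * y x = - y'' x + complex_of_real (q x) * y x"
    using y unfolding sl_expr_def by blast
  let ?A = "\<lambda>x. complex_of_real (- (3 * n * ramp l n x ^ 2))"
  let ?A' = "\<lambda>x. complex_of_real (6 * n\<^sup>2 * ramp l n x)"
  let ?B = "\<lambda>x. complex_of_real (ramp l n x ^ 3)"
  have B: "(?B has_vector_derivative ?A x) (at x within S)" for x S
    using DERIV_ramp_power[of 3 l n x S] by (simp add: mult_ac)
  have A: "(?A has_vector_derivative ?A' x) (at x within S)" for x S
    using has_vector_derivative_mult_right[OF DERIV_ramp_power[of 2 l n x S], of "complex_of_real (- 3 * n)"]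
    by (simp add: power2_eq_square[of n] mult_ac)
  have contA: "continuous_on S ?A" and contA': "continuous_on S ?A'" for S
    by (intro continuous_intros continuous_on_ramp)+
  have yC: "loc_abs_cont l y y'"
    using y' sl_expr_continuous[OF y] by (intro loc_abs_cont_C1) auto
  have "loc_abs_cont l (\<lambda>x. ?A x * y x + 1 * (?B x * y' x))
      (\<lambda>x. (?A' x * y x + ?A x * y' x) + 1 * (?A x * y' x + ?B x * y'' x))"
    by (intro loc_abs_cont_add loc_abs_cont_mult A B contA contA' yC y'')
  then have "loc_abs_cont l (cutoff_deriv l n y y')
      (\<lambda>x. (?A' x * y x + ?A x * y' x) + (?A x * y' x + ?B x * y'' x))"
    unfolding cutoff_deriv_def by (simp only: mult_1)
  moreover have "AE x in lebesgue_on {l..}. cutoff_image z l n y y' x =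
      - ((?A' x * y x + ?A x * y' x) + (?A x * y' x + ?B x * y'' x)) +
      complex_of_real (q x) * cutoff l n y x"
    using ae
  proof eventually_elim
    case (elim x)
    have "cutoff_image z l n y y' x = ?B x * (z * y x) - ?A' x * y x - 2 * ?A x * y' x"
      by (simp add: cutoff_image_def)
    then show ?case
      unfolding elim cutoff_def by (simp add: algebra_simps)
  qed
  moreover have "\<forall>x\<ge>l. (cutoff l n y has_vector_derivative cutoff_deriv l n y y' x) (at x within {l..})"
    unfolding cutoff_def cutoff_deriv_def
    using has_vector_derivative_mult[OF B y'[rule_format]] by (simp add: add.commute)
  ultimately show ?thesis
    unfolding sl_expr_def by blast
qed

lemma cutoff_in_max_domain:
  assumes y: "sl_expr l q y y' (\<lambda>x. z * y x)" and n: "n > 0"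
  shows "in_max_domain l q (cutoff l n y) (cutoff_deriv l n y y') (cutoff_image z l n y y')"
proof -
  note cont = sl_expr_continuous[OF y]
  have sq: "square_integrable l f"
    if f: "continuous_on {l..} f" and supp: "\<And>x. l + 1 / n \<le> x \<Longrightarrow> f x = 0"
    for f :: "real \<Rightarrow> complex"
  proof -
    have "continuous_on {l..l + 1 / n} f"
      by (rule continuous_on_subset[OF f]) auto
    then have "bounded (f ` {l..l + 1 / n})"
      by (intro compact_imp_bounded compact_continuous_image) auto
    then obtain C where "\<forall>x\<in>{l..l + 1 / n}. cmod (f x) \<le> C"
      unfolding bounded_iff by auto
    then show ?thesis
      using n supp f
      by (intro L2_sq_bounded_support(1)[of l "l + 1 / n" f C] continuous_imp_measurable_on_sets_lebesgue)
         auto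
  qed
  have "square_integrable l (cutoff l n y)"
  proof (rule sq)
    show "continuous_on {l..} (cutoff l n y)"
      unfolding cutoff_def by (intro continuous_intros continuous_on_ramp cont)
  qed (use cutoff_support[OF n] in auto)
  moreover have "square_integrable l (cutoff_image z l n y y')"
  proof (rule sq)
    show "continuous_on {l..} (cutoff_image z l n y y')"
      unfolding cutoff_image_def by (intro continuous_intros continuous_on_ramp cont)
  qed (use cutoff_support[OF n] in auto)
  ultimately show ?thesis
    using cutoff_sl_expr[OF y] by (simp add: in_max_domain_def)
qed

text \<open>If \<open>y l = 0\<close>, then \<open>y\<close> is of size \<open>1 / n\<close> on the support of the cut-off, which makes the cut-off of
  size \<open>1 / n\<close> and its image of size \<open>n\<close>.  The product of the two bounds tends to \<open>0\<close>: a cut-off with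
  prescribed slope at \<open>l\<close> costs no energy in the limit.\<close>

lemma cutoff_bounds:
  assumes y: "sl_expr l q y y' (\<lambda>x. - 1 * y x)" and y0: "y l = 0"
  obtains C where "C > 0"
    "\<And>n. n \<ge> 1 \<Longrightarrow> L2_sq l (cutoff l n y) \<le> C / n ^ 3"
    "\<And>n. n \<ge> 1 \<Longrightarrow> L2_sq l (cutoff_image (- 1) l n y y') \<le> C * n"
proof -
  note cont = sl_expr_continuous[OF y]
  have "continuous_on {l..l + 1} y'"
    by (rule continuous_on_subset[OF cont(2)]) auto
  then have "bounded (y' ` {l..l + 1})"
    by (intro compact_imp_bounded compact_continuous_image) auto
  then obtain C where "C > 0" and C: "\<forall>x\<in>{l..l + 1}. cmod (y' x) \<le> C"
    unfolding bounded_pos by auto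
  have y_le: "cmod (y x) \<le> C / n" if n: "n \<ge> 1" and x: "x \<in> {l..l + 1 / n}" for n x
  proof -
    have n1: "1 / n \<le> 1" using n by simp
    have "(y' has_integral (y x - y l)) {l..x}"
      using y x by (intro fundamental_theorem_of_calculus)
        (auto simp: sl_expr_def intro: has_vector_derivative_within_subset)
    then have "cmod (y x - y l) \<le> C * Henstock_Kurzweil_Integration.content {l..x}"
      using C x n1 \<open>C > 0\<close> by (intro has_integral_bound_real[of C "{}"]) auto
    also have "\<dots> \<le> C * (1 / n)"
      using \<open>C > 0\<close> x by (intro mult_left_mono) auto
    finally show ?thesis by (simp add: y0)
  qed
  have y'_le: "cmod (y' x) \<le> C" if n: "n \<ge> 1" and x: "x \<in> {l..l + 1 / n}" for n x
  proof -
    have "1 / n \<le> 1" using n by simp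
    then show ?thesis using C x by auto
  qed
  have meas: "f \<in> borel_measurable (lebesgue_on {l..})" if "continuous_on {l..} f" for f :: "real \<Rightarrow> complex"
    using that by (rule continuous_imp_measurable_on_sets_lebesgue) simp
  have "L2_sq l (cutoff l n y) \<le> (169 * C\<^sup>2) / n ^ 3" if n: "n \<ge> 1" for n
  proof -
    have "L2_sq l (cutoff l n y) \<le> (C / n)\<^sup>2 * (l + 1 / n - l)"
    proof (rule L2_sq_bounded_support(2))
      fix x assume x: "x \<in> {l..l + 1 / n}"
      have "cmod (cutoff l n y x) = ramp l n x ^ 3 * cmod (y x)"
        using ramp_nonneg by (simp add: cutoff_def norm_mult norm_power)
      also have "\<dots> \<le> 1 * (C / n)"
        using y_le[OF n x] ramp_nonneg[of l n x] ramp_le_1[of n l x] n x \<open>C > 0\<close>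
        by (intro mult_mono power_le_one) auto
      finally show "cmod (cutoff l n y x) \<le> C / n" by simp
    next
      show "cutoff l n y \<in> borel_measurable (lebesgue_on {l..})"
        unfolding cutoff_def by (intro meas continuous_intros continuous_on_ramp cont)
    qed (use n cutoff_support[of n] in auto)
    also have "\<dots> = C\<^sup>2 / n ^ 3"
      by (simp add: power2_eq_square power3_eq_cube)
    also have "\<dots> \<le> (169 * C\<^sup>2) / n ^ 3"
      using n by (intro divide_right_mono) auto
    finally show ?thesis .
  qed
  moreover have "L2_sq l (cutoff_image (- 1) l n y y') \<le> (169 * C\<^sup>2) * n" if n: "n \<ge> 1" for n
  proof -
    have "L2_sq l (cutoff_image (- 1) l n y y') \<le> (13 * C * n)\<^sup>2 * (l + 1 / n - l)"
    proof (rule L2_sq_bounded_support(2))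
      fix x assume x: "x \<in> {l..l + 1 / n}"
      let ?r = "ramp l n x"
      have r: "0 \<le> ?r" "?r \<le> 1" using ramp_nonneg[of l n x] ramp_le_1[of n l x] n x by auto
      have "1 / n \<le> 1" using n by simp
      then have n1: "1 / n \<le> n" using n by linarith
      have t1: "cmod (complex_of_real (?r ^ 3) * y x) \<le> 1 * (C / n)"
        unfolding norm_mult using y_le[OF n x] r \<open>C > 0\<close> n
        by (intro mult_mono) (auto simp: norm_power intro!: power_le_one)
      have t2: "cmod (complex_of_real (6 * n\<^sup>2 * ?r) * y x) \<le> (6 * n\<^sup>2 * 1) * (C / n)"
        unfolding norm_mult using y_le[OF n x] r \<open>C > 0\<close> n
        by (intro mult_mono) (auto simp: norm_mult norm_power)
      have t3: "cmod (complex_of_real (6 * n * ?r ^ 2) * y' x) \<le> (6 * n * 1) * C"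
        unfolding norm_mult using y'_le[OF n x] r \<open>C > 0\<close> n
        by (intro mult_mono) (auto simp: norm_mult norm_power intro!: power_le_one)
      have "cmod (cutoff_image (- 1) l n y y' x) \<le> 1 * (C / n) + (6 * n\<^sup>2 * 1) * (C / n) + (6 * n * 1) * C"
        unfolding cutoff_image_def
        using t1 t2 t3
        by (intro order_trans[OF norm_triangle_ineq] order_trans[OF norm_triangle_ineq4] add_mono) auto
      also have "(6 * n\<^sup>2 * 1) * (C / n) = 6 * n * C"
        using n by (simp add: power2_eq_square)
      also have "1 * (C / n) \<le> n * C"
        using mult_right_mono[OF n1, of C] \<open>C > 0\<close> by simp
      finally show "cmod (cutoff_image (- 1) l n y y' x) \<le> 13 * C * n" by simp
    next
      show "cutoff_image (- 1) l n y y' \<in> borel_measurable (lebesgue_on {l..})"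
        unfolding cutoff_image_def by (intro meas continuous_intros continuous_on_ramp cont)
    qed (use n cutoff_support[of n] in auto)
    also have "\<dots> = (169 * C\<^sup>2) * n"
      using n by (simp add: power2_eq_square)
    finally show ?thesis .
  qed
  moreover have "169 * C\<^sup>2 > 0" using \<open>C > 0\<close> by simp
  ultimately show ?thesis using that by blast
qed

section \<open>Non-negativity and Green's identity without boundary terms at infinity\<close>

lemma in_max_domainD:
  assumes "in_max_domain l q y y' h"
  shows "square_integrable l y" "square_integrable l h"
  using assms by (auto simp: in_max_domain_def)

lemma L2_inner_scale_left: "L2_inner l (\<lambda>x. c * f x) g = c * L2_inner l f g"
  by (simp add: L2_inner_def mult.assoc)

lemma L2_inner_scale_right: "L2_inner l f (\<lambda>x. c * g x) = cnj c * L2_inner l f g"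
  by (metis L2_inner_cnj L2_inner_scale_left complex_cnj_mult)

text \<open>The boundary form at infinity: the amount by which Green's identity with boundary terms at \<open>l\<close> alone
  fails.\<close>

definition green_defect where
  "green_defect l f f' h g g' k =
     L2_inner l h g - L2_inner l f k - (f' l * cnj (g l) - f l * cnj (g' l))"

lemma green_defect_cnj:
  "green_defect l g g' k f f' h = - cnj (green_defect l f f' h g g' k)"
  unfolding green_defect_def
  using L2_inner_cnj[of l k f] L2_inner_cnj[of l g h] by (simp add: algebra_simps)

lemma green_defect_add_left:
  assumes "in_max_domain l q f f' h" "in_max_domain l q u u' j" "in_max_domain l q g g' k"
  shows "green_defect l (\<lambda>x. f x + c * u x) (\<lambda>x. f' x + c * u' x) (\<lambda>x. h x + c * j x) g g' k =
    green_defect l f f' h g g' k + c * green_defect l u u' j g g' k"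
  unfolding green_defect_def
  using assms[THEN in_max_domainD(1)] assms[THEN in_max_domainD(2)]
  by (simp add: L2_inner_add_left) (simp add: algebra_simps)

lemma green_defect_add_right:
  assumes "in_max_domain l q f f' h" "in_max_domain l q u u' j" "in_max_domain l q g g' k"
  shows "green_defect l g g' k (\<lambda>x. f x + c * u x) (\<lambda>x. f' x + c * u' x) (\<lambda>x. h x + c * j x) =
    green_defect l g g' k f f' h + cnj c * green_defect l g g' k u u' j"
  using green_defect_add_left[OF assms, of c]
  by (simp add: green_defect_cnj[of l g g' k])

lemma tendsto_0_if_cmod_power2_le:
  fixes a :: "nat \<Rightarrow> complex"
  assumes "\<And>n. (cmod (a n))\<^sup>2 \<le> K / real (Suc n)"
  shows "a \<longlonglongrightarrow> 0"
proof -
  have "(\<lambda>n. K * (1 / real (Suc n))) \<longlonglongrightarrow> K * 0"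
    by (intro tendsto_intros LIMSEQ_Suc[OF lim_1_over_n])
  then have "(\<lambda>n. K / real (Suc n)) \<longlonglongrightarrow> 0" by simp
  then have "(\<lambda>n. (cmod (a n))\<^sup>2) \<longlonglongrightarrow> 0"
    by (rule Lim_null_comparison[rotated]) (use assms in \<open>auto intro!: always_eventually\<close>)
  then have "(\<lambda>n. sqrt ((cmod (a n))\<^sup>2)) \<longlonglongrightarrow> sqrt 0"
    by (rule tendsto_real_sqrt)
  then show ?thesis
    by (simp add: tendsto_norm_zero_iff)
qed

lemma minus_1_off_nonneg: "- 1 \<notin> (\<real>\<^sub>\<ge>\<^sub>0 :: complex set)"
  by (simp add: complex_nonneg_Reals_iff)

text \<open>\<open>\<psi> z\<close> are the Weyl solutions; \<open>\<phi>\<close> is the solution for \<open>z = -1\<close> with Dirichlet data, which is cut off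
  to supply test functions of slope \<open>1\<close>.\<close>

locale weyl_solutions =
  fixes l :: real and q :: "real \<Rightarrow> real" and m :: "complex \<Rightarrow> complex"
    and \<psi> \<psi>' :: "complex \<Rightarrow> real \<Rightarrow> complex" and \<phi> \<phi>' :: "real \<Rightarrow> complex"
  assumes nonneg: "nonnegative_op l (minimal_op l q)"
    and \<psi>: "\<And>z. z \<notin> \<real>\<^sub>\<ge>\<^sub>0 \<Longrightarrow> in_max_domain l q (\<psi> z) (\<psi>' z) (\<lambda>x. z * \<psi> z x)"
    and \<psi>_start: "\<And>z. z \<notin> \<real>\<^sub>\<ge>\<^sub>0 \<Longrightarrow> \<psi> z l = - 1" "\<And>z. z \<notin> \<real>\<^sub>\<ge>\<^sub>0 \<Longrightarrow> \<psi>' z l = m z"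
    and \<phi>: "sl_expr l q \<phi> \<phi>' (\<lambda>x. - 1 * \<phi> x)"
    and \<phi>_start: "\<phi> l = 0" "\<phi>' l = 1"
begin

abbreviation "G n \<equiv> cutoff l n \<phi>"
abbreviation "G' n \<equiv> cutoff_deriv l n \<phi> \<phi>'"
abbreviation "AG n \<equiv> cutoff_image (- 1) l n \<phi> \<phi>'"

lemma G_in_max_domain: "n > 0 \<Longrightarrow> in_max_domain l q (G n) (G' n) (AG n)"
  using \<phi> by (rule cutoff_in_max_domain)

lemma G_start: "G n l = 0" "G' n l = 1"
  by (simp_all add: cutoff_def cutoff_deriv_def \<phi>_start ramp_start)

lemma green_defect_cutoff:
  assumes f: "in_max_domain l q f f' h" and n: "n > 0"
    and y: "sl_expr l q y y' (\<lambda>x. z * y x)"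
  shows "green_defect l f f' h (cutoff l n y) (cutoff_deriv l n y y') (cutoff_image z l n y y') = 0"
  unfolding green_defect_def
  using green_identity_compact[OF f cutoff_in_max_domain[OF y n], of "l + 1 / n"]
    cutoff_support[OF n] n by simp

lemma minimal_nonneg:
  assumes "in_max_domain l q f f' h" "f l = 0" "f' l = 0"
  shows "L2_inner l h f \<in> \<real>\<^sub>\<ge>\<^sub>0"
proof -
  have "(f, h) \<in> minimal_op l q"
    using assms unfolding minimal_op_def in_max_domain_def by blast
  then show ?thesis
    using nonneg unfolding nonnegative_op_def by blast
qed

text \<open>The Dirichlet extension inherits non-negativity, because it is the Friedrichs extension: subtracting
  \<open>f' l\<close> times the cut-off \<open>G n\<close> from \<open>f\<close> produces elements of the minimal domain, and the form of
  \<open>f - f' l * G n\<close> converges to the form of \<open>f\<close>.\<close>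

lemma dirichlet_nonneg:
  assumes f: "in_max_domain l q f f' h" and f0: "f l = 0"
  shows "L2_inner l h f \<in> \<real>\<^sub>\<ge>\<^sub>0"
proof -
  obtain C where C: "C > 0"
    and g_le: "\<And>n. n \<ge> 1 \<Longrightarrow> L2_sq l (G n) \<le> C / n ^ 3"
    and k_le: "\<And>n. n \<ge> 1 \<Longrightarrow> L2_sq l (AG n) \<le> C * n"
    using cutoff_bounds[OF \<phi> \<phi>_start(1)] by blast
  define c where "c = f' l"
  define a where "a n = L2_inner l h (G (real (Suc n)))" for n
  define b where "b n = L2_inner l (AG (real (Suc n))) (G (real (Suc n)))" for n
  \<comment> \<open>The form of \<open>f - c * G (n + 1)\<close>, expanded.\<close>
  define X where "X n = L2_inner l h f - cnj c * a n - c * cnj (a n) + c * cnj c * b n" for n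
  note fD = in_max_domainD[OF f]
  have a0: "a \<longlonglongrightarrow> 0"
  proof (rule tendsto_0_if_cmod_power2_le)
    fix n
    let ?n = "real (Suc n)"
    have "(cmod (a n))\<^sup>2 \<le> L2_sq l h * L2_sq l (G ?n)"
      unfolding a_def by (intro L2_Cauchy_Schwarz fD in_max_domainD(1)[OF G_in_max_domain]) simp
    also have "\<dots> \<le> L2_sq l h * (C / ?n ^ 3)"
      by (intro mult_left_mono g_le L2_sq_nonneg) simp
    also have "\<dots> \<le> L2_sq l h * (C / ?n ^ 1)"
      using C by (intro mult_left_mono L2_sq_nonneg divide_left_mono power_increasing) auto
    finally show "(cmod (a n))\<^sup>2 \<le> (L2_sq l h * C) / ?n" by simp
  qed
  have b0: "b \<longlonglongrightarrow> 0"
  proof (rule tendsto_0_if_cmod_power2_le)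
    fix n
    let ?n = "real (Suc n)"
    have "(cmod (b n))\<^sup>2 \<le> L2_sq l (AG ?n) * L2_sq l (G ?n)"
      unfolding b_def by (intro L2_Cauchy_Schwarz in_max_domainD[OF G_in_max_domain]) simp_all
    also have "\<dots> \<le> (C * ?n) * (C / ?n ^ 3)"
      using C by (intro mult_mono g_le k_le L2_sq_nonneg) simp_all
    also have "\<dots> = C\<^sup>2 / ?n ^ 2"
      by (simp add: power2_eq_square power3_eq_cube)
    also have "\<dots> \<le> C\<^sup>2 / ?n ^ 1"
      by (intro divide_left_mono power_increasing) auto
    finally show "(cmod (b n))\<^sup>2 \<le> C\<^sup>2 / ?n" by simp
  qed
  have "X n \<in> \<real>\<^sub>\<ge>\<^sub>0" for n
  proof -
    let ?n = "real (Suc n)"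
    have n: "?n > 0" by simp
    note G = G_in_max_domain[OF n]
    note GD = in_max_domainD[OF G]
    let ?f = "\<lambda>x. f x + (- c) * G ?n x" and ?h = "\<lambda>x. h x + (- c) * AG ?n x"
    have fn: "in_max_domain l q ?f (\<lambda>x. f' x + (- c) * G' ?n x) ?h"
      using f G by (rule in_max_domain_add)
    have "green_defect l f f' h (G ?n) (G' ?n) (AG ?n) = 0"
      using green_defect_cutoff[OF f n \<phi>] .
    then have sym: "L2_inner l f (AG ?n) = a n"
      by (simp add: green_defect_def a_def f0 G_start)
    have "L2_inner l ?h ?f = L2_inner l h ?f + (- c) * L2_inner l (AG ?n) ?f"
      by (rule L2_inner_add_left[OF fD(2) GD(2) in_max_domainD(1)[OF fn]])
    also have "L2_inner l h ?f = L2_inner l h f - cnj c * a n"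
      using L2_inner_add_right[OF fD(1) GD(1) fD(2), of "- c"] by (simp add: a_def)
    also have "L2_inner l (AG ?n) ?f = cnj (a n) - cnj c * b n"
      using L2_inner_add_right[OF fD(1) GD(1) GD(2), of "- c"] L2_inner_cnj[of l "AG ?n" f, unfolded sym]
      by (simp add: b_def)
    finally have "L2_inner l ?h ?f = X n"
      by (simp add: X_def algebra_simps)
    moreover have "L2_inner l ?h ?f \<in> \<real>\<^sub>\<ge>\<^sub>0"
      by (rule minimal_nonneg[OF fn]) (auto simp: f0 G_start c_def)
    ultimately show ?thesis by simp
  qed
  moreover have "X \<longlonglongrightarrow> L2_inner l h f - cnj c * 0 - c * cnj 0 + c * cnj c * 0"
    unfolding X_def by (intro tendsto_intros a0 b0)
  ultimately show ?thesis
    using closed_sequentially[OF closed_nonneg_Reals_complex, of X "L2_inner l h f"] by simp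
qed

text \<open>The form of the minimal operator is real on the diagonal, so polarization makes the operator
  symmetric.\<close>

lemma minimal_symmetric:
  assumes f: "in_max_domain l q f f' h" "f l = 0" "f' l = 0"
    and g: "in_max_domain l q g g' k" "g l = 0" "g' l = 0"
  shows "green_defect l f f' h g g' k = 0"
proof -
  have self: "green_defect l u u' j u u' j = 0"
    if "in_max_domain l q u u' j" "u l = 0" "u' l = 0" for u u' j
  proof -
    have "L2_inner l j u \<in> \<real>"
      using minimal_nonneg[OF that] nonneg_Reals_subset_Reals by blast
    then show ?thesis
      using that L2_inner_cnj[of l u j] by (simp add: green_defect_def Reals_cnj_iff)
  qed
  let ?\<Delta> = "green_defect l f f' h g g' k"
  have polar: "c * cnj ?\<Delta> = cnj c * ?\<Delta>" for c
  proof -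
    let ?u = "\<lambda>x. f x + c * g x" and ?u' = "\<lambda>x. f' x + c * g' x" and ?j = "\<lambda>x. h x + c * k x"
    have u: "in_max_domain l q ?u ?u' ?j"
      using f(1) g(1) by (rule in_max_domain_add)
    have "0 = green_defect l ?u ?u' ?j ?u ?u' ?j"
      using self[OF u] f g by simp
    also have "\<dots> = green_defect l f f' h ?u ?u' ?j + c * green_defect l g g' k ?u ?u' ?j"
      by (rule green_defect_add_left[OF f(1) g(1) u])
    also have "green_defect l f f' h ?u ?u' ?j = cnj c * ?\<Delta>"
      using green_defect_add_right[OF f(1) g(1) f(1), of c] self[OF f] by simp
    also have "green_defect l g g' k ?u ?u' ?j = - cnj ?\<Delta>"
      using green_defect_add_right[OF f(1) g(1) g(1), of c] self[OF g] green_defect_cnj[of l g g' k f f' h]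
      by simp
    finally show ?thesis by simp
  qed
  from polar[of 1] have "cnj ?\<Delta> = ?\<Delta>" by simp
  with polar[of \<i>] have "\<i> * ?\<Delta> = - \<i> * ?\<Delta>" by simp
  then show ?thesis by simp
qed

text \<open>There are no boundary terms at infinity: modulo two compactly supported functions, which adjust the
  boundary data at \<open>l\<close> and contribute nothing at infinity, both arguments lie in the minimal domain,
  where the operator is symmetric.\<close>

lemma green_identity:
  assumes f: "in_max_domain l q f f' h" and g: "in_max_domain l q g g' k"
  shows "L2_inner l h g - L2_inner l f k = f' l * cnj (g l) - f l * cnj (g' l)"
proof -
  let ?e = "\<psi> (- 1)" and ?e' = "\<psi>' (- 1)"
  have e: "sl_expr l q ?e ?e' (\<lambda>x. - 1 * ?e x)"
    using \<psi>[OF minus_1_off_nonneg] unfolding in_max_domain_def by blast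
  let ?E = "cutoff l 1 ?e" and ?E' = "cutoff_deriv l 1 ?e ?e'" and ?AE = "cutoff_image (- 1) l 1 ?e ?e'"
  have E: "in_max_domain l q ?E ?E' ?AE"
    using cutoff_in_max_domain[OF e, of 1] by simp
  have E_start: "?E l = - 1"
    using \<psi>_start(1)[OF minus_1_off_nonneg] by (simp add: cutoff_def ramp_start)
  have G: "in_max_domain l q (G 1) (G' 1) (AG 1)"
    by (rule G_in_max_domain) simp
  have ex: "\<exists>a b u u' j. u = (\<lambda>x. (f x + a * ?E x) + b * G 1 x) \<and>
      u' = (\<lambda>x. (f' x + a * ?E' x) + b * G' 1 x) \<and> j = (\<lambda>x. (h x + a * ?AE x) + b * AG 1 x) \<and>
      in_max_domain l q u u' j \<and> u l = 0 \<and> u' l = 0"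
    if f: "in_max_domain l q f f' h" for f f' h
    apply (rule exI[of _ "f l"], rule exI[of _ "- (f' l + f l * ?E' l)"])
    using in_max_domain_add[OF in_max_domain_add[OF f E] G, of "f l" "- (f' l + f l * ?E' l)"]
    by (simp add: E_start G_start)
  obtain a b u u' j where u: "u = (\<lambda>x. (f x + a * ?E x) + b * G 1 x)"
      "u' = (\<lambda>x. (f' x + a * ?E' x) + b * G' 1 x)" "j = (\<lambda>x. (h x + a * ?AE x) + b * AG 1 x)"
      "in_max_domain l q u u' j" "u l = 0" "u' l = 0"
    using ex[OF f] by blast
  obtain c d v v' i where v: "v = (\<lambda>x. (g x + c * ?E x) + d * G 1 x)"
      "v' = (\<lambda>x. (g' x + c * ?E' x) + d * G' 1 x)" "i = (\<lambda>x. (k x + c * ?AE x) + d * AG 1 x)"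
      "in_max_domain l q v v' i" "v l = 0" "v' l = 0"
    using ex[OF g] by blast
  have zero: "green_defect l w w' p ?E ?E' ?AE = 0" "green_defect l w w' p (G 1) (G' 1) (AG 1) = 0"
    "green_defect l ?E ?E' ?AE w w' p = 0" "green_defect l (G 1) (G' 1) (AG 1) w w' p = 0"
    if "in_max_domain l q w w' p" for w w' p
    using green_defect_cutoff[OF that _ e, of 1] green_defect_cutoff[OF that _ \<phi>, of 1]
      green_defect_cnj[of l ?E ?E' ?AE w w' p] green_defect_cnj[of l "G 1" "G' 1" "AG 1" w w' p]
    by simp_all
  have "0 = green_defect l u u' j v v' i"
    using minimal_symmetric[OF u(4-6) v(4-6)] by simp
  also have "\<dots> = green_defect l u u' j g g' k"
    unfolding v(1-3)
    using green_defect_add_right[OF in_max_domain_add[OF g E] G u(4), of c d]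
      green_defect_add_right[OF g E u(4), of c] zero[OF u(4)] by simp
  also have "\<dots> = green_defect l f f' h g g' k"
    unfolding u(1-3)
    using green_defect_add_left[OF in_max_domain_add[OF f E] G g, of a b]
      green_defect_add_left[OF f E g, of a] zero[OF g] by simp
  finally show ?thesis by (simp add: green_defect_def)
qed

section \<open>The Weyl-Titchmarsh function\<close>

definition K where "K z w = L2_inner l (\<psi> z) (\<psi> w)"

lemma K_cnj: "K w z = cnj (K z w)"
  unfolding K_def by (rule L2_inner_cnj)

lemma K_self: "K z z = complex_of_real (L2_sq l (\<psi> z))"
  unfolding K_def by (rule L2_inner_self)

lemma \<psi>_square_integrable: "z \<notin> \<real>\<^sub>\<ge>\<^sub>0 \<Longrightarrow> square_integrable l (\<psi> z)"
  using \<psi> in_max_domainD(1) by blast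

lemma weyl_kernel:
  assumes "z \<notin> \<real>\<^sub>\<ge>\<^sub>0" "w \<notin> \<real>\<^sub>\<ge>\<^sub>0"
  shows "(z - cnj w) * K z w = cnj (m w) - m z"
  using green_identity[OF \<psi>[OF assms(1)] \<psi>[OF assms(2)]] \<psi>_start assms
  by (simp add: L2_inner_scale_left L2_inner_scale_right K_def algebra_simps)

lemma cnj_off_nonneg: "z \<notin> \<real>\<^sub>\<ge>\<^sub>0 \<Longrightarrow> cnj z \<notin> \<real>\<^sub>\<ge>\<^sub>0"
  by (simp add: complex_nonneg_Reals_iff)

lemma m_cnj:
  assumes "z \<notin> \<real>\<^sub>\<ge>\<^sub>0"
  shows "cnj (m z) = m (cnj z)"
  using weyl_kernel[OF cnj_off_nonneg[OF assms] assms] by simp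

lemma Im_m:
  assumes "z \<notin> \<real>\<^sub>\<ge>\<^sub>0"
  shows "Im (m z) = - Im z * L2_sq l (\<psi> z)"
  using arg_cong[OF weyl_kernel[OF assms assms], of Im] by (simp add: K_self)

text \<open>A Weyl solution of norm \<open>0\<close> would be orthogonal to everything by the Cauchy-Schwarz inequality; Green's
  identity against a cut-off with slope \<open>1\<close> at \<open>l\<close> excludes that.\<close>

lemma \<psi>_pos:
  assumes z: "z \<notin> \<real>\<^sub>\<ge>\<^sub>0"
  shows "0 < L2_sq l (\<psi> z)"
proof (rule ccontr)
  assume "\<not> ?thesis"
  then have 0: "L2_sq l (\<psi> z) = 0" using L2_sq_nonneg[of l "\<psi> z"] by simp
  have orth: "L2_inner l (\<psi> z) g = 0" if "square_integrable l g" for g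
    using L2_Cauchy_Schwarz[OF \<psi>_square_integrable[OF z] that] 0 by simp
  have G: "in_max_domain l q (G 1) (G' 1) (AG 1)"
    by (rule G_in_max_domain) simp
  show False
    using green_identity[OF \<psi>[OF z] G] orth[OF in_max_domainD(1)[OF G]] orth[OF in_max_domainD(2)[OF G]]
      \<psi>_start[OF z] G_start[of 1]
    by (simp add: L2_inner_scale_left)
qed

text \<open>With \<open>t\<close> the form of \<open>f\<close> and \<open>n\<close> its squared norm, this bounds the Dirichlet operator minus \<open>w\<close> from
  below.\<close>

lemma resolvent_bound:
  assumes w: "w \<notin> \<real>\<^sub>\<ge>\<^sub>0"
  obtains \<delta> where "\<delta> > 0"
    "\<And>t n. t \<ge> 0 \<Longrightarrow> n \<ge> 0 \<Longrightarrow> \<delta> * n \<le> cmod (complex_of_real t - w * complex_of_real n)"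
proof (cases "Im w = 0")
  case True
  then have neg: "Re w < 0" using w by (auto simp: complex_nonneg_Reals_iff)
  show ?thesis
  proof (rule that[of "- Re w"])
    fix t n :: real assume "t \<ge> 0" "n \<ge> 0"
    then have "- Re w * n \<le> \<bar>Re (complex_of_real t - w * complex_of_real n)\<bar>"
      by simp
    also have "\<dots> \<le> cmod (complex_of_real t - w * complex_of_real n)"
      by (rule abs_Re_le_cmod)
    finally show "- Re w * n \<le> cmod (complex_of_real t - w * complex_of_real n)" .
  qed (use neg in simp)
next
  case False
  show ?thesis
  proof (rule that[of "\<bar>Im w\<bar>"])
    fix t n :: real assume "t \<ge> 0" "n \<ge> 0"
    then have "\<bar>Im w\<bar> * n = \<bar>Im (complex_of_real t - w * complex_of_real n)\<bar>"
      by (simp add: abs_mult)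
    also have "\<dots> \<le> cmod (complex_of_real t - w * complex_of_real n)"
      by (rule abs_Im_le_cmod)
    finally show "\<bar>Im w\<bar> * n \<le> cmod (complex_of_real t - w * complex_of_real n)" .
  qed (use False in simp)
qed

lemma \<psi>_diff:
  assumes "z \<notin> \<real>\<^sub>\<ge>\<^sub>0" "w \<notin> \<real>\<^sub>\<ge>\<^sub>0"
  shows "in_max_domain l q (\<lambda>x. \<psi> z x + (- 1) * \<psi> w x) (\<lambda>x. \<psi>' z x + (- 1) * \<psi>' w x)
      (\<lambda>x. z * \<psi> z x + (- 1) * (w * \<psi> w x))"
    "\<psi> z l + (- 1) * \<psi> w l = 0"
  using in_max_domain_add[OF \<psi>[OF assms(1)] \<psi>[OF assms(2)], of "- 1"] \<psi>_start assms by auto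

text \<open>The difference \<open>f = \<psi> z - \<psi> w\<close> satisfies the Dirichlet condition, and the operator minus \<open>z\<close> maps it to
  \<open>(z - w) \<psi> w\<close>; the lower bound for the Dirichlet operator then controls \<open>f\<close>.\<close>

lemma \<psi>_lipschitz:
  assumes w: "w \<notin> \<real>\<^sub>\<ge>\<^sub>0"
  obtains \<delta> where "\<delta> > 0"
    "\<And>z. z \<notin> \<real>\<^sub>\<ge>\<^sub>0 \<Longrightarrow> cmod (z - w) \<le> \<delta> / 2 \<Longrightarrow>
      L2_sq l (\<lambda>x. \<psi> z x + (- 1) * \<psi> w x) \<le> (cmod (z - w))\<^sup>2 * (4 * L2_sq l (\<psi> w) / \<delta>\<^sup>2)"
proof -
  obtain \<delta> where \<delta>: "\<delta> > 0"
    "\<And>t n. t \<ge> 0 \<Longrightarrow> n \<ge> 0 \<Longrightarrow> \<delta> * n \<le> cmod (complex_of_real t - w * complex_of_real n)"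
    using resolvent_bound[OF w] by blast
  show ?thesis
  proof (rule that[OF \<delta>(1)])
    fix z assume z: "z \<notin> \<real>\<^sub>\<ge>\<^sub>0" and zw: "cmod (z - w) \<le> \<delta> / 2"
    let ?f = "\<lambda>x. \<psi> z x + (- 1) * \<psi> w x" and ?h = "\<lambda>x. z * \<psi> z x + (- 1) * (w * \<psi> w x)"
    note f = \<psi>_diff[OF z w]
    note fD = in_max_domainD[OF f(1)]
    let ?n = "L2_sq l ?f"
    have n: "?n \<ge> 0" by (rule L2_sq_nonneg)
    obtain t where t: "t \<ge> 0" "L2_inner l ?h ?f = complex_of_real t"
      using dirichlet_nonneg[OF f] by (auto elim: nonneg_Reals_cases)
    have "L2_inner l (\<lambda>x. ?h x + (- z) * ?f x) ?f = complex_of_real t - z * complex_of_real ?n"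
      using L2_inner_add_left[OF fD(2) fD(1) fD(1), of "- z"] t(2) by (simp add: L2_inner_self)
    moreover have "(\<lambda>x. ?h x + (- z) * ?f x) = (\<lambda>x. (z - w) * \<psi> w x)"
      by (auto simp: fun_eq_iff algebra_simps)
    ultimately have eq: "complex_of_real t - z * complex_of_real ?n = (z - w) * L2_inner l (\<psi> w) ?f"
      by (simp only: L2_inner_scale_left)
    have "\<delta> * ?n \<le> cmod (complex_of_real t - w * complex_of_real ?n)"
      by (rule \<delta>(2)[OF t(1) n])
    also have "complex_of_real t - w * complex_of_real ?n =
        (complex_of_real t - z * complex_of_real ?n) + (z - w) * complex_of_real ?n"
      by (simp add: algebra_simps)
    also have "cmod \<dots> \<le> cmod (z - w) * cmod (L2_inner l (\<psi> w) ?f) + cmod (z - w) * ?n"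
      unfolding eq
      using norm_triangle_ineq[of "(z - w) * L2_inner l (\<psi> w) ?f" "(z - w) * complex_of_real ?n"] n
      by (simp add: norm_mult)
    also have "\<dots> \<le> cmod (z - w) * cmod (L2_inner l (\<psi> w) ?f) + \<delta> / 2 * ?n"
      using zw n by (intro add_left_mono mult_right_mono)
    finally have "\<delta> / 2 * ?n \<le> cmod (z - w) * cmod (L2_inner l (\<psi> w) ?f)"
      by simp
    then have "(\<delta> / 2 * ?n)\<^sup>2 \<le> (cmod (z - w) * cmod (L2_inner l (\<psi> w) ?f))\<^sup>2"
      using n \<delta>(1) by (intro power_mono) auto
    also have "\<dots> = (cmod (z - w))\<^sup>2 * (cmod (L2_inner l (\<psi> w) ?f))\<^sup>2"
      by (simp add: power_mult_distrib)
    also have "\<dots> \<le> (cmod (z - w))\<^sup>2 * (L2_sq l (\<psi> w) * ?n)"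
      by (intro mult_left_mono L2_Cauchy_Schwarz \<psi>_square_integrable w fD) simp
    finally have le: "?n * (\<delta>\<^sup>2 / 4 * ?n) \<le> ?n * ((cmod (z - w))\<^sup>2 * L2_sq l (\<psi> w))"
      by (simp add: power2_eq_square algebra_simps)
    show "?n \<le> (cmod (z - w))\<^sup>2 * (4 * L2_sq l (\<psi> w) / \<delta>\<^sup>2)"
    proof (cases "?n = 0")
      case True
      then show ?thesis by (simp add: L2_sq_nonneg)
    next
      case False
      then have "\<delta>\<^sup>2 / 4 * ?n \<le> (cmod (z - w))\<^sup>2 * L2_sq l (\<psi> w)"
        using le n by (simp only: mult_le_cancel_left)
      then show ?thesis using \<delta>(1) by (simp add: field_simps)
    qed
  qed
qed

text \<open>By the kernel identity the difference quotient of \<open>m\<close> equals \<open>- K z (cnj w)\<close>, so holomorphy reduces to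
  the continuity of \<open>z \<mapsto> \<psi> z\<close> in \<open>L\<^sub>2\<close>.\<close>

lemma m_has_derivative:
  assumes w: "w \<notin> \<real>\<^sub>\<ge>\<^sub>0"
  shows "(m has_field_derivative - K w (cnj w)) (at w)"
proof -
  note cw = cnj_off_nonneg[OF w]
  obtain \<delta> where \<delta>: "\<delta> > 0"
    "\<And>z. z \<notin> \<real>\<^sub>\<ge>\<^sub>0 \<Longrightarrow> cmod (z - w) \<le> \<delta> / 2 \<Longrightarrow>
      L2_sq l (\<lambda>x. \<psi> z x + (- 1) * \<psi> w x) \<le> (cmod (z - w))\<^sup>2 * (4 * L2_sq l (\<psi> w) / \<delta>\<^sup>2)"
    using \<psi>_lipschitz[OF w] by blast
  define B where "B = 4 * L2_sq l (\<psi> w) / \<delta>\<^sup>2 * L2_sq l (\<psi> (cnj w))"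
  have B: "B \<ge> 0"
    unfolding B_def by (intro mult_nonneg_nonneg divide_nonneg_nonneg L2_sq_nonneg) auto
  have near: "\<forall>\<^sub>F z in at w. z \<notin> \<real>\<^sub>\<ge>\<^sub>0 \<and> z \<noteq> w \<and> cmod (z - w) \<le> \<delta> / 2"
  proof (intro eventually_conj)
    have "open (- \<real>\<^sub>\<ge>\<^sub>0 :: complex set)"
      by (simp add: open_Compl)
    then show "\<forall>\<^sub>F z in at w. z \<notin> \<real>\<^sub>\<ge>\<^sub>0"
      using eventually_at_topological w by auto
    show "\<forall>\<^sub>F z in at w. z \<noteq> w"
      by (rule eventually_neq_at_within)
    show "\<forall>\<^sub>F z in at w. cmod (z - w) \<le> \<delta> / 2"
      unfolding eventually_at using \<delta>(1) by (intro exI[of _ "\<delta> / 2"]) (auto simp: dist_norm)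
  qed
  have "((\<lambda>z. (m z - m w) / (z - w) - (- K w (cnj w))) \<longlongrightarrow> 0) (at w)"
  proof (rule Lim_null_comparison)
    show "\<forall>\<^sub>F z in at w. norm ((m z - m w) / (z - w) - (- K w (cnj w))) \<le> cmod (z - w) * sqrt B"
      using near
    proof eventually_elim
      case (elim z)
      let ?f = "\<lambda>x. \<psi> z x + (- 1) * \<psi> w x"
      have "(m z - m w) / (z - w) = - K z (cnj w)"
        using weyl_kernel[of z "cnj w"] m_cnj[OF cw] elim cw
        by (simp add: field_simps)
      then have "(m z - m w) / (z - w) - (- K w (cnj w)) = - L2_inner l ?f (\<psi> (cnj w))"
        using L2_inner_add_left[of l "\<psi> z" "\<psi> w" "\<psi> (cnj w)" "- 1"] elim w cw
        by (simp add: K_def \<psi>_square_integrable)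
      moreover have "(cmod (L2_inner l ?f (\<psi> (cnj w))))\<^sup>2 \<le> (cmod (z - w))\<^sup>2 * B"
      proof -
        have "(cmod (L2_inner l ?f (\<psi> (cnj w))))\<^sup>2 \<le> L2_sq l ?f * L2_sq l (\<psi> (cnj w))"
          using elim w cw
          by (intro L2_Cauchy_Schwarz \<psi>_square_integrable in_max_domainD(1)[OF \<psi>_diff(1)]) auto
        also have "\<dots> \<le> (cmod (z - w))\<^sup>2 * (4 * L2_sq l (\<psi> w) / \<delta>\<^sup>2) * L2_sq l (\<psi> (cnj w))"
          using elim by (intro mult_right_mono \<delta>(2) L2_sq_nonneg) auto
        finally show ?thesis by (simp add: B_def mult.assoc)
      qed
      then have "cmod (L2_inner l ?f (\<psi> (cnj w))) \<le> sqrt ((cmod (z - w))\<^sup>2 * B)"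
        by (rule real_le_rsqrt)
      ultimately show ?case
        by (simp add: real_sqrt_mult)
    qed
    have "((\<lambda>z. cmod (z - w) * sqrt B) \<longlongrightarrow> cmod (w - w) * sqrt B) (at w)"
      by (intro tendsto_intros)
    then show "((\<lambda>z. cmod (z - w) * sqrt B) \<longlongrightarrow> 0) (at w)" by simp
  qed
  then show ?thesis
    unfolding has_field_derivative_iff by (simp only: LIM_zero_iff)
qed

text \<open>Apply the non-negativity of the Dirichlet operator to \<open>\<psi> z - \<psi> x\<close> with \<open>x < 0\<close>, express the inner
  products through \<open>m\<close>, drop the non-positive term \<open>x * L2_sq l (\<psi> x)\<close>, and let \<open>x\<close> tend to \<open>0\<close>.  Formally
  the right-hand side is the Neumann form of \<open>\<psi> z\<close>, that is, \<open>\<integral> |\<psi>'|\<^sup>2 + q |\<psi>|\<^sup>2\<close>.\<close>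

lemma m_lower_bound:
  assumes lim: "((\<lambda>x. m (complex_of_real x)) \<longlongrightarrow> complex_of_real m\<^sub>0) (at_left 0)"
    and z: "z \<notin> \<real>\<^sub>\<ge>\<^sub>0"
  shows "m\<^sub>0 \<le> Re z * L2_sq l (\<psi> z) + Re (m z)"
proof -
  have z0: "z \<noteq> 0" using z by auto
  have step: "Re ((z + complex_of_real x) * (m (complex_of_real x) - m z) / (z - complex_of_real x))
      \<le> Re z * L2_sq l (\<psi> z)" if x: "x < 0" and ne: "complex_of_real x \<noteq> z" for x
  proof -
    let ?x = "complex_of_real x"
    have xD: "?x \<notin> \<real>\<^sub>\<ge>\<^sub>0" using x by (simp add: complex_nonneg_Reals_iff)
    note f = \<psi>_diff[OF z xD]
    note fD = in_max_domainD[OF f(1)]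
    have sq: "square_integrable l (\<psi> z)" "square_integrable l (\<psi> ?x)"
      using z xD by (auto intro: \<psi>_square_integrable)
    let ?f = "\<lambda>y. \<psi> z y + (- 1) * \<psi> ?x y" and ?h = "\<lambda>y. z * \<psi> z y + (- 1) * (?x * \<psi> ?x y)"
    have "L2_inner l ?h ?f = z * L2_inner l (\<psi> z) ?f - ?x * L2_inner l (\<psi> ?x) ?f"
      using L2_inner_add_left[OF square_integrable_scale[OF sq(1)] square_integrable_scale[OF sq(2)] fD(1), of z "- 1" ?x]
      by (simp add: L2_inner_scale_left)
    also have "L2_inner l (\<psi> z) ?f = K z z - K z ?x"
      using L2_inner_add_right[OF sq sq(1), of "- 1"] by (simp add: K_def)
    also have "L2_inner l (\<psi> ?x) ?f = cnj (K z ?x) - K ?x ?x"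
      using L2_inner_add_right[OF sq sq(2), of "- 1"] K_cnj[of ?x z] by (simp add: K_def)
    finally have "L2_inner l ?h ?f = z * (K z z - K z ?x) - ?x * (cnj (K z ?x) - K ?x ?x)" .
    moreover have "0 \<le> Re (L2_inner l ?h ?f)"
      using dirichlet_nonneg[OF f] by (simp add: complex_nonneg_Reals_iff)
    ultimately have "0 \<le> Re (z * (K z z - K z ?x) - ?x * (cnj (K z ?x) - K ?x ?x))"
      by (simp only:)
    then have "0 \<le> Re z * L2_sq l (\<psi> z) - Re ((z + ?x) * K z ?x) + x * L2_sq l (\<psi> ?x)"
      by (simp add: K_self algebra_simps)
    moreover have "x * L2_sq l (\<psi> ?x) \<le> 0"
      using x L2_sq_nonneg by (intro mult_nonpos_nonneg) auto
    moreover have "K z ?x = (m ?x - m z) / (z - ?x)"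
      using weyl_kernel[OF z xD] m_cnj[OF xD] ne by (simp add: field_simps)
    ultimately show ?thesis by simp
  qed
  have lim_x: "((\<lambda>x. complex_of_real x) \<longlongrightarrow> complex_of_real 0) (at_left 0)"
    by (intro tendsto_intros)
  have "((\<lambda>x. Re ((z + complex_of_real x) * (m (complex_of_real x) - m z) / (z - complex_of_real x)))
      \<longlongrightarrow> Re ((z + complex_of_real 0) * (complex_of_real m\<^sub>0 - m z) / (z - complex_of_real 0))) (at_left 0)"
    using z0 by (intro tendsto_intros lim lim_x) auto
  moreover have "\<forall>\<^sub>F x in at_left 0.
      Re ((z + complex_of_real x) * (m (complex_of_real x) - m z) / (z - complex_of_real x))
      \<le> Re z * L2_sq l (\<psi> z)"
  proof -
    have "\<forall>\<^sub>F x in at_left (0 :: real). x < 0"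
      by (simp add: eventually_at_filter)
    moreover have "\<forall>\<^sub>F x in at_left (0 :: real). complex_of_real x \<noteq> z"
    proof -
      have "\<forall>\<^sub>F x in at_left (0 :: real). complex_of_real x \<in> - {z}"
        by (rule topological_tendstoD[OF lim_x]) (use z0 in \<open>auto intro: open_Compl\<close>)
      then show ?thesis by simp
    qed
    ultimately show ?thesis by eventually_elim (rule step)
  qed
  ultimately have "Re ((z + complex_of_real 0) * (complex_of_real m\<^sub>0 - m z) / (z - complex_of_real 0))
      \<le> Re z * L2_sq l (\<psi> z)"
    by (rule tendsto_upperbound) simp
  then show ?thesis using z0 by simp
qed

text \<open>Green's identity for \<open>\<psi> (- n\<^sup>2)\<close> and the cut-off \<open>G n\<close> has a right-hand side of modulus \<open>1\<close>, whereas both terms on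
  the left are of order \<open>n\<^sup>1\<^sup>/\<^sup>2\<close> times the norm of \<open>\<psi> (- n\<^sup>2)\<close>.  Hence that squared norm is at least of
  order \<open>1 / n\<close>, and the lower bound for \<open>m\<close> grows linearly in \<open>n\<close>.\<close>

lemma m_unbounded:
  assumes lim: "((\<lambda>x. m (complex_of_real x)) \<longlongrightarrow> complex_of_real m\<^sub>0) (at_left 0)"
  obtains c where "c > 0" "\<And>n. n \<ge> 1 \<Longrightarrow> m\<^sub>0 + c * n \<le> Re (m (complex_of_real (- n\<^sup>2)))"
proof -
  obtain C where C: "C > 0"
    and g_le: "\<And>n. n \<ge> 1 \<Longrightarrow> L2_sq l (G n) \<le> C / n ^ 3"
    and k_le: "\<And>n. n \<ge> 1 \<Longrightarrow> L2_sq l (AG n) \<le> C * n"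
    using cutoff_bounds[OF \<phi> \<phi>_start(1)] by blast
  show ?thesis
  proof (rule that[of "1 / (4 * C)"])
    fix n :: real assume n: "n \<ge> 1"
    let ?z = "complex_of_real (- n\<^sup>2)"
    have z: "?z \<notin> \<real>\<^sub>\<ge>\<^sub>0"
      using n by (simp add: complex_nonneg_Reals_iff)
    have G: "in_max_domain l q (G n) (G' n) (AG n)"
      using n by (intro G_in_max_domain) simp
    let ?N = "L2_sq l (\<psi> ?z)"
    let ?a = "L2_inner l (AG n) (\<psi> ?z)" and ?b = "L2_inner l (G n) (\<psi> ?z)"
    have "?a - cnj ?z * ?b = - 1"
      using green_identity[OF G \<psi>[OF z]] \<psi>_start[OF z] G_start[of n]
      by (simp only: L2_inner_scale_right) simp
    then have "1 = cmod (?a - cnj ?z * ?b)" by simp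
    also have "\<dots> \<le> cmod ?a + n\<^sup>2 * cmod ?b"
      using norm_triangle_ineq4[of ?a "cnj ?z * ?b"] by (simp add: norm_mult norm_power)
    finally have "1 \<le> (cmod ?a + n\<^sup>2 * cmod ?b)\<^sup>2"
      by (simp add: one_le_power)
    also have "\<dots> \<le> 2 * (cmod ?a)\<^sup>2 + 2 * (n\<^sup>2 * cmod ?b)\<^sup>2"
      using sum_squares_bound[of "cmod ?a" "n\<^sup>2 * cmod ?b"] by (simp add: power2_sum)
    also have "(cmod ?a)\<^sup>2 \<le> (C * n) * ?N"
      using L2_Cauchy_Schwarz[OF in_max_domainD(2)[OF G] \<psi>_square_integrable[OF z]]
        mult_right_mono[OF k_le[OF n] L2_sq_nonneg[of l "\<psi> ?z"]] by linarith
    also have "(n\<^sup>2 * cmod ?b)\<^sup>2 \<le> (C * n) * ?N"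
    proof -
      have "(cmod ?b)\<^sup>2 \<le> C / n ^ 3 * ?N"
        using L2_Cauchy_Schwarz[OF in_max_domainD(1)[OF G] \<psi>_square_integrable[OF z]]
          mult_right_mono[OF g_le[OF n] L2_sq_nonneg[of l "\<psi> ?z"]] by linarith
      then have "n ^ 4 * (cmod ?b)\<^sup>2 \<le> n ^ 4 * (C / n ^ 3 * ?N)"
        by (intro mult_left_mono) auto
      also have "\<dots> = (C * n) * ?N"
        using n by (simp add: power_def field_simps numeral_eq_Suc)
      finally show ?thesis by (simp add: power_mult_distrib flip: power_mult)
    qed
    finally have "1 \<le> 4 * C * n * ?N" by simp
    then have "1 / (4 * C) * n \<le> n\<^sup>2 * ?N"
      using C n by (simp add: field_simps power2_eq_square)
    then show "m\<^sub>0 + 1 / (4 * C) * n \<le> Re (m ?z)"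
      using m_lower_bound[OF lim z] by simp
  qed (use C in simp)
qed

end

section \<open>Stieltjes criteria for the transforms of a Weyl function\<close>

text \<open>With \<open>k = c / s\<close>, the expression divided by \<open>s\<^sup>2\<close> is
  \<open>(1 + k\<^sup>2) (r + a - k) + k ((a - k)\<^sup>2 + b\<^sup>2)\<close>.\<close>

lemma stieltjes_quadratic_nonneg:
  fixes a b r s c :: real
  assumes s: "s \<noteq> 0" and cs: "c\<^sup>2 + s\<^sup>2 = 1" and k: "0 \<le> c / s" and r: "c / s \<le> r + a"
  shows "0 \<le> (s\<^sup>2 - c\<^sup>2) * a + s * c * (a\<^sup>2 + b\<^sup>2 - 1) + r"
proof -
  define k where "k = c / s"
  have c: "c = k * s" using s by (simp add: k_def)
  have s2: "s\<^sup>2 * (1 + k\<^sup>2) = 1" using cs by (simp add: c power_mult_distrib algebra_simps)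
  have "(s\<^sup>2 - c\<^sup>2) * a + s * c * (a\<^sup>2 + b\<^sup>2 - 1) + r
      = s\<^sup>2 * ((1 - k\<^sup>2) * a + k * (a\<^sup>2 + b\<^sup>2 - 1)) + s\<^sup>2 * (1 + k\<^sup>2) * r"
    by (simp add: s2) (simp add: c power2_eq_square algebra_simps)
  also have "\<dots> = s\<^sup>2 * ((1 + k\<^sup>2) * (r + a - k) + k * ((a - k)\<^sup>2 + b\<^sup>2))"
    by (simp add: power2_eq_square algebra_simps)
  also have "\<dots> \<ge> 0"
    using assms by (intro mult_nonneg_nonneg add_nonneg_nonneg) (auto simp: k_def)
  finally show ?thesis .
qed

text \<open>The converse: large \<open>v\<close> force \<open>k = c / s\<close> to be non-negative, and then the factor \<open>v - k\<close> would be
  negative for \<open>v\<close> just below \<open>k\<close> if \<open>m\<^sub>0 < k\<close>.\<close>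

lemma stieltjes_angle:
  fixes s c m\<^sub>0 :: real
  assumes cs: "c\<^sup>2 + s\<^sup>2 = 1" and H: "\<And>v. v > m\<^sub>0 \<Longrightarrow> 0 \<le> (s * v - c) * (c * v + s)"
  shows "s \<noteq> 0" "0 \<le> c / s" "c / s \<le> m\<^sub>0"
proof -
  show s: "s \<noteq> 0"
  proof
    assume s: "s = 0"
    define v where "v = max m\<^sub>0 0 + 1"
    have "(s * v - c) * (c * v + s) = - (c\<^sup>2 * v)"
      by (simp add: s power2_eq_square)
    moreover have "c\<^sup>2 = 1" using cs s by simp
    ultimately have "(s * v - c) * (c * v + s) < 0" by (simp add: v_def)
    moreover have "v > m\<^sub>0" by (simp add: v_def max_def)
    ultimately show False using H[of v] by simp
  qed
  define k where "k = c / s"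
  have c: "c = k * s" using s by (simp add: k_def)
  have H': "0 \<le> (v - k) * (k * v + 1)" if "v > m\<^sub>0" for v
  proof -
    have "0 \<le> s\<^sup>2 * ((v - k) * (k * v + 1))"
      using H[OF that] by (simp add: c power2_eq_square algebra_simps)
    then show ?thesis using s by (simp add: zero_le_mult_iff)
  qed
  have k: "0 \<le> k"
  proof (rule ccontr)
    assume "\<not> 0 \<le> k"
    then have neg: "k < 0" by simp
    define v where "v = max m\<^sub>0 (max 0 (- 1 / k)) + 1"
    have "v > - 1 / k" "v > 0" "v > m\<^sub>0" by (auto simp: v_def)
    then have "k * v + 1 < 0" "v - k > 0" using neg by (auto simp: field_simps)
    then have "(v - k) * (k * v + 1) < 0" by (simp add: mult_pos_neg)
    with H'[OF \<open>v > m\<^sub>0\<close>] show False by simp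
  qed
  moreover have "k \<le> m\<^sub>0"
  proof (rule ccontr)
    assume "\<not> k \<le> m\<^sub>0"
    \<comment> \<open>Above \<open>m\<^sub>0\<close>, and so close below \<open>k\<close> that \<open>k * v + 1\<close> stays positive.\<close>
    define v where "v = max ((m\<^sub>0 + k) / 2) (k - 1 / (2 * (k + 1)))"
    have "v > m\<^sub>0" "v < k"
      using \<open>\<not> k \<le> m\<^sub>0\<close> k by (auto simp: v_def less_max_iff_disj)
    have "k * v + 1 \<ge> k * (k - 1 / (2 * (k + 1))) + 1"
      using k by (intro add_right_mono mult_left_mono) (auto simp: v_def)
    moreover have "k * (k - 1 / (2 * (k + 1))) + 1 > 0"
    proof -
      have "k * (1 / (2 * (k + 1))) < 1" using k by (simp add: field_simps)
      then show ?thesis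
        using mult_nonneg_nonneg[OF k k] unfolding right_diff_distrib by linarith
    qed
    ultimately have "(v - k) * (k * v + 1) < 0"
      using \<open>v < k\<close> by (intro mult_neg_pos) auto
    with H'[OF \<open>v > m\<^sub>0\<close>] show False by simp
  qed
  ultimately show "0 \<le> c / s" "c / s \<le> m\<^sub>0" by (simp_all add: k_def)
qed

lemma moebius_numerator:
  fixes s c :: real and w :: complex
  defines "u \<equiv> - ((of_real s + w * of_real c) * cnj (of_real c - w * of_real s))"
  shows "Re u = (s\<^sup>2 - c\<^sup>2) * Re w + s * c * ((cmod w)\<^sup>2 - 1)"
    "Im u = - Im w * (s\<^sup>2 + c\<^sup>2)"
  unfolding u_def cmod_power2 by (simp_all add: power2_eq_square algebra_simps)

lemma ext_recip_le_ext_tan_iff: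
  "0 < ext_recip m\<^sub>0 \<and> ext_recip m\<^sub>0 \<le> ext_tan \<alpha> \<longleftrightarrow>
     sin \<alpha> \<noteq> 0 \<and> 0 \<le> cos \<alpha> / sin \<alpha> \<and> cos \<alpha> / sin \<alpha> \<le> m\<^sub>0"
proof (cases "cos \<alpha> = 0")
  case True
  then have "sin \<alpha> \<noteq> 0" using sin_zero_abs_cos_one by fastforce
  then show ?thesis using True by (auto simp: ext_recip_def ext_tan_def)
next
  case False
  show ?thesis
  proof (cases "sin \<alpha> = 0")
    case True
    then show ?thesis using False by (auto simp: ext_recip_def ext_tan_def tan_def)
  next
    case s: False
    have t: "cos \<alpha> / sin \<alpha> = 1 / tan \<alpha>" "tan \<alpha> \<noteq> 0" using s False by (auto simp: tan_def)
    have "0 < 1 / m\<^sub>0 \<and> 1 / m\<^sub>0 \<le> T \<longleftrightarrow> 0 \<le> 1 / T \<and> 1 / T \<le> m\<^sub>0"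
      if "m\<^sub>0 \<noteq> 0" "T \<noteq> 0" for T
    proof
      assume A: "0 < 1 / m\<^sub>0 \<and> 1 / m\<^sub>0 \<le> T"
      have T: "0 < T" using A by linarith
      have m\<^sub>0: "0 < m\<^sub>0" using A by simp
      have "1 \<le> m\<^sub>0 * T" using A by (simp add: pos_divide_le_eq m\<^sub>0 mult.commute)
      then have "1 / T \<le> m\<^sub>0" by (simp add: pos_divide_le_eq T)
      then show "0 \<le> 1 / T \<and> 1 / T \<le> m\<^sub>0" using T by simp
    next
      assume A: "0 \<le> 1 / T \<and> 1 / T \<le> m\<^sub>0"
      then have T: "0 < T" using that by (simp add: zero_le_divide_iff)
      then have "0 < 1 / T" by simp
      then have m\<^sub>0: "0 < m\<^sub>0" using A by linarith
      have "1 \<le> m\<^sub>0 * T" using A by (simp add: pos_divide_le_eq T mult.commute)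
      then have "1 / m\<^sub>0 \<le> T" by (simp add: pos_divide_le_eq m\<^sub>0 mult.commute)
      then show "0 < 1 / m\<^sub>0 \<and> 1 / m\<^sub>0 \<le> T" using m\<^sub>0 by simp
    qed
    then show ?thesis
      unfolding t(1) using s False t(2)
      by (cases "m\<^sub>0 = 0") (auto simp: ext_recip_def ext_tan_def)
  qed
qed

lemma minus_le_ext_tan_iff:
  "- ereal m\<^sub>0 \<le> ext_tan \<alpha> \<and> ext_tan \<alpha> \<le> 0 \<longleftrightarrow>
     cos \<alpha> \<noteq> 0 \<and> 0 \<le> - sin \<alpha> / cos \<alpha> \<and> - sin \<alpha> / cos \<alpha> \<le> m\<^sub>0"
  by (auto simp: ext_tan_def tan_def zero_ereal_def simp del: ereal_eq_0)

text \<open>The properties of the Weyl-Titchmarsh function that decide the Stieltjes classes; \<open>N z\<close> is the squared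
  norm of the Weyl solution.  Monotonicity of \<open>m\<close> on the negative half-axis is replaced by \<open>lower\<close>, and
  \<open>unbounded\<close> excludes the bounded Herglotz functions that satisfy all the other properties.\<close>

locale weyl_function =
  fixes m :: "complex \<Rightarrow> complex" and N :: "complex \<Rightarrow> real" and m\<^sub>0 :: real
  assumes holo: "m holomorphic_on - \<real>\<^sub>\<ge>\<^sub>0"
    and cnj_m: "\<And>z. z \<notin> \<real>\<^sub>\<ge>\<^sub>0 \<Longrightarrow> cnj (m z) = m (cnj z)"
    and Im_m: "\<And>z. z \<notin> \<real>\<^sub>\<ge>\<^sub>0 \<Longrightarrow> Im (m z) = - Im z * N z"
    and N_pos: "\<And>z. z \<notin> \<real>\<^sub>\<ge>\<^sub>0 \<Longrightarrow> 0 < N z"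
    and lower: "\<And>z. z \<notin> \<real>\<^sub>\<ge>\<^sub>0 \<Longrightarrow> m\<^sub>0 \<le> Re z * N z + Re (m z)"
    and unbounded: "\<And>B. \<exists>x<0. B \<le> Re (m (complex_of_real x))"
    and lim: "((\<lambda>x. m (complex_of_real x)) \<longlongrightarrow> complex_of_real m\<^sub>0) (at_left 0)"
begin

lemma neg_off_nonneg: "x < 0 \<Longrightarrow> complex_of_real x \<notin> \<real>\<^sub>\<ge>\<^sub>0"
  by (simp add: complex_nonneg_Reals_iff)

lemma nonreal_off_nonneg: "z \<notin> \<real> \<Longrightarrow> z \<notin> \<real>\<^sub>\<ge>\<^sub>0"
  using nonneg_Reals_subset_Reals by blast

lemma m_neg_real: "x < 0 \<Longrightarrow> m (complex_of_real x) = complex_of_real (Re (m (complex_of_real x)))"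
  using Im_m[OF neg_off_nonneg] by (simp add: complex_eq_iff)

lemma m_neg_gt:
  assumes "x < 0" shows "m\<^sub>0 < Re (m (complex_of_real x))"
proof -
  have "x * N (complex_of_real x) < 0"
    using assms N_pos[OF neg_off_nonneg] by (simp add: mult_neg_pos)
  then show ?thesis using lower[OF neg_off_nonneg[OF assms]] by simp
qed

lemma m_neg_onto:
  assumes v: "v > m\<^sub>0"
  obtains x where "x < 0" "m (complex_of_real x) = complex_of_real v"
proof -
  let ?\<mu> = "\<lambda>x. Re (m (complex_of_real x))"
  obtain x1 where x1: "x1 < 0" "v \<le> ?\<mu> x1" using unbounded by blast
  have "((\<lambda>x. ?\<mu> x) \<longlongrightarrow> Re (complex_of_real m\<^sub>0)) (at_left 0)"
    by (intro tendsto_intros lim)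
  then have "\<forall>\<^sub>F x in at_left 0. ?\<mu> x < v"
    using v by (intro order_tendstoD(2)) auto
  moreover have "\<forall>\<^sub>F x in at_left 0. x1 < x"
    using x1(1) by (intro eventually_at_left_field[THEN iffD2]) auto
  moreover have "\<forall>\<^sub>F x in at_left (0::real). x < 0"
    by (simp add: eventually_at_filter)
  ultimately have "\<forall>\<^sub>F x in at_left 0. ?\<mu> x < v \<and> x1 < x \<and> x < 0"
    by eventually_elim auto
  then obtain x2 where x2: "?\<mu> x2 < v" "x1 < x2" "x2 < 0"
    using eventually_happens[of _ "at_left (0::real)"] by (metis (mono_tags, lifting) trivial_limit_at_left_real)
  have "continuous_on {x1..x2} ?\<mu>"
  proof (intro continuous_intros)
    show "continuous_on {x1..x2} (\<lambda>x. m (complex_of_real x))"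
      by (rule continuous_on_compose2[OF holomorphic_on_imp_continuous_on[OF holo]])
         (use x2 neg_off_nonneg in \<open>auto intro!: continuous_intros\<close>)
  qed
  then obtain x where "x1 \<le> x" "x \<le> x2" "?\<mu> x = v"
    using IVT2'[of ?\<mu> x2 v x1] x1 x2 by auto
  with that[of x] m_neg_real[of x] x2 show ?thesis by simp
qed

text \<open>On the negative half-axis \<open>m\<close> takes every value above \<open>m\<^sub>0\<close>, and this half-axis is approached from the
  upper half-plane; closed conditions on nonreal values thus pass to all real numbers \<open>v > m\<^sub>0\<close>.\<close>

lemma neg_axis_closure:
  assumes S: "closed S" and m: "\<And>z. z \<notin> \<real> \<Longrightarrow> Re z < 0 \<Longrightarrow> m z \<in> S" and v: "v > m\<^sub>0"
  shows "complex_of_real v \<in> S"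
proof -
  obtain x where x: "x < 0" "m (complex_of_real x) = complex_of_real v"
    using m_neg_onto[OF v] .
  define \<zeta> where "\<zeta> n = Complex x (1 / real (Suc n))" for n
  have nr: "\<zeta> n \<notin> \<real>" for n by (simp add: \<zeta>_def complex_is_Real_iff)
  have "(\<lambda>n. Complex x (1 / real (Suc n))) \<longlonglongrightarrow> Complex x 0"
    by (intro tendsto_Complex tendsto_const LIMSEQ_Suc[OF lim_1_over_n])
  then have \<zeta>: "\<zeta> \<longlonglongrightarrow> complex_of_real x"
    by (simp add: \<zeta>_def [abs_def] complex_of_real_def)
  have "(\<lambda>n. m (\<zeta> n)) \<longlonglongrightarrow> m (complex_of_real x)"
    by (rule continuous_on_tendsto_compose[OF holomorphic_on_imp_continuous_on[OF holo] \<zeta>])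
       (use x neg_off_nonneg nonreal_off_nonneg[OF nr] in auto)
  moreover have "m (\<zeta> n) \<in> S" for n
    using m[OF nr] x by (simp add: \<zeta>_def)
  ultimately show ?thesis
    using closed_sequentially[OF S, of "\<lambda>n. m (\<zeta> n)" "complex_of_real v"] x by simp
qed

lemma m_nonreal: "z \<notin> \<real> \<Longrightarrow> Im (m z) \<noteq> 0"
  using Im_m[OF nonreal_off_nonneg] N_pos[OF nonreal_off_nonneg, of z]
  by (simp add: complex_is_Real_iff)

lemma denominator_nonzero:
  assumes "z \<notin> \<real>"
  shows "complex_of_real (cos \<alpha>) - m z * complex_of_real (sin \<alpha>) \<noteq> 0"
proof
  assume eq: "complex_of_real (cos \<alpha>) - m z * complex_of_real (sin \<alpha>) = 0"
  have "Im (complex_of_real (cos \<alpha>) - m z * complex_of_real (sin \<alpha>)) = 0"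
    unfolding eq by simp
  then have "Im (m z) * sin \<alpha> = 0" by simp
  then have "sin \<alpha> = 0" using m_nonreal[OF assms] by simp
  moreover from this eq have "cos \<alpha> = 0" by simp
  ultimately show False using sin_cos_squared_add[of \<alpha>] by simp
qed

text \<open>The numerator of the real part of \<open>- m_alpha\<close> as a function of \<open>w = m z\<close>; it factorizes for real \<open>w\<close>.\<close>

definition Q where
  "Q \<alpha> w = ((sin \<alpha>)\<^sup>2 - (cos \<alpha>)\<^sup>2) * Re w + sin \<alpha> * cos \<alpha> * ((cmod w)\<^sup>2 - 1)"

definition den where
  "den \<alpha> z = (cmod (complex_of_real (cos \<alpha>) - m z * complex_of_real (sin \<alpha>)))\<^sup>2"

lemma den_pos: "z \<notin> \<real> \<Longrightarrow> 0 < den \<alpha> z"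
  using denominator_nonzero by (simp add: den_def)

lemma m_alpha_parts:
  assumes "z \<notin> \<real>"
  shows "Re (- m_alpha m \<alpha> z) = Q \<alpha> (m z) / den \<alpha> z"
    "Im (- m_alpha m \<alpha> z) = Im z * N z / den \<alpha> z"
proof -
  let ?s = "complex_of_real (sin \<alpha>)" and ?c = "complex_of_real (cos \<alpha>)"
  have "- m_alpha m \<alpha> z = - ((?s + m z * ?c) * cnj (?c - m z * ?s)) / complex_of_real (den \<alpha> z)"
    unfolding m_alpha_def den_def by (subst complex_div_cnj) simp
  then show "Re (- m_alpha m \<alpha> z) = Q \<alpha> (m z) / den \<alpha> z"
    "Im (- m_alpha m \<alpha> z) = Im z * N z / den \<alpha> z"
    using Im_m[OF nonreal_off_nonneg[OF assms]]
    by (simp_all only: Re_divide_of_real Im_divide_of_real moebius_numerator Q_def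
        sin_cos_squared_add mult_1_right minus_mult_minus mult_minus_left minus_minus)
qed

lemma m_alpha_herglotz: "herglotz_nevanlinna (\<lambda>z. - m_alpha m \<alpha> z)"
  unfolding herglotz_nevanlinna_def
proof (intro conjI allI impI)
  have "m holomorphic_on - \<real>"
    using holo by (rule holomorphic_on_subset) (use nonreal_off_nonneg in auto)
  then show "(\<lambda>z. - m_alpha m \<alpha> z) holomorphic_on - \<real>"
    unfolding m_alpha_def using denominator_nonzero by (intro holomorphic_intros) auto
next
  fix z :: complex assume "z \<notin> \<real>"
  then show "cnj (- m_alpha m \<alpha> z) = - m_alpha m \<alpha> (cnj z)"
    using cnj_m[OF nonreal_off_nonneg] by (simp add: m_alpha_def)
next
  fix z assume "0 < Im z"
  then have "z \<notin> \<real>" by (auto simp: complex_is_Real_iff)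
  then show "0 \<le> Im (- m_alpha m \<alpha> z)"
    using \<open>0 < Im z\<close> N_pos[OF nonreal_off_nonneg, of z] den_pos[of z \<alpha>]
    unfolding m_alpha_parts(2)[OF \<open>z \<notin> \<real>\<close>] by simp
qed

lemma m_alpha_extends:
  assumes "\<And>v. v > m\<^sub>0 \<Longrightarrow> v * sin \<alpha> \<noteq> cos \<alpha>"
  shows "extends_off_nonneg (\<lambda>z. - m_alpha m \<alpha> z)"
proof -
  have "complex_of_real (cos \<alpha>) - m z * complex_of_real (sin \<alpha>) \<noteq> 0" if z: "z \<notin> \<real>\<^sub>\<ge>\<^sub>0" for z
  proof (cases "z \<in> \<real>")
    case True
    then obtain x where x: "z = complex_of_real x" by (auto elim: Reals_cases)
    then have "x < 0" using z by (simp add: complex_nonneg_Reals_iff)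
    then have "m z = complex_of_real (Re (m z))" "Re (m z) > m\<^sub>0"
      using m_neg_real m_neg_gt x by auto
    then show ?thesis
      using assms[of "Re (m z)"] by (metis eq_iff_diff_eq_0 of_real_eq_iff of_real_mult)
  qed (rule denominator_nonzero)
  then have "(\<lambda>z. - m_alpha m \<alpha> z) holomorphic_on - \<real>\<^sub>\<ge>\<^sub>0"
    unfolding m_alpha_def using holo by (intro holomorphic_intros) auto
  then show ?thesis
    unfolding extends_off_nonneg_def by blast
qed

lemma m_alpha_stieltjes_quotient:
  assumes "z \<notin> \<real>"
  shows "Im (z * - m_alpha m \<alpha> z) / Im z = (Q \<alpha> (m z) + Re z * N z) / den \<alpha> z"
proof -
  have "Im z \<noteq> 0" using assms by (simp add: complex_is_Real_iff)
  then show ?thesis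
    using m_alpha_parts[OF assms, of \<alpha>] den_pos[OF assms, of \<alpha>]
    by (simp only: times_complex.sel) (simp add: field_simps)
qed

lemma m_alpha_inverse_stieltjes_quotient:
  assumes "z \<notin> \<real>"
  shows "Im (- m_alpha m \<alpha> z / z) / Im z = (Re z * N z - Q \<alpha> (m z)) / (den \<alpha> z * (cmod z)\<^sup>2)"
proof -
  have "Im z \<noteq> 0" using assms by (simp add: complex_is_Real_iff)
  moreover from this have "cmod z > 0" by auto
  moreover have "Im (- m_alpha m \<alpha> z / z)
      = (Im (- m_alpha m \<alpha> z) * Re z - Re (- m_alpha m \<alpha> z) * Im z) / (cmod z)\<^sup>2"
    by (simp only: Im_divide cmod_power2)
  ultimately show ?thesis
    unfolding m_alpha_parts[OF assms, of \<alpha>] using den_pos[OF assms, of \<alpha>]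
    by (simp add: field_simps)
qed

lemma Q_of_real: "Q \<alpha> (complex_of_real v) = (sin \<alpha> * v - cos \<alpha>) * (cos \<alpha> * v + sin \<alpha>)"
  unfolding Q_def by (simp add: power2_eq_square algebra_simps)

lemma continuous_on_Q: "continuous_on UNIV (Q \<alpha>)"
  unfolding Q_def by (intro continuous_intros)

text \<open>Both implications compare \<open>Q \<alpha> (m z) + Re z * N z\<close> with \<open>0\<close>.  For necessity the second summand is negative
  when \<open>Re z < 0\<close>, so that \<open>Q \<alpha>\<close> is non-negative on all real \<open>v > m\<^sub>0\<close>.\<close>

lemma stieltjes_m_alpha_iff:
  "stieltjes (\<lambda>z. - m_alpha m \<alpha> z) \<longleftrightarrow>
     sin \<alpha> \<noteq> 0 \<and> 0 \<le> cos \<alpha> / sin \<alpha> \<and> cos \<alpha> / sin \<alpha> \<le> m\<^sub>0" (is "?L \<longleftrightarrow> ?R")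
proof
  assume L: ?L
  have Q: "0 \<le> Q \<alpha> (m z)" if z: "z \<notin> \<real>" "Re z < 0" for z
  proof -
    have "Im z \<noteq> 0" using z by (simp add: complex_is_Real_iff)
    then have "0 \<le> Im (z * - m_alpha m \<alpha> z) / Im z"
      using L by (simp add: stieltjes_def)
    then have "0 \<le> Q \<alpha> (m z) + Re z * N z"
      unfolding m_alpha_stieltjes_quotient[OF z(1)] using den_pos[OF z(1), of \<alpha>]
      by (simp add: zero_le_divide_iff)
    moreover have "Re z * N z < 0"
      using z N_pos[OF nonreal_off_nonneg] by (simp add: mult_neg_pos)
    ultimately show ?thesis by simp
  qed
  have "closed {w. 0 \<le> Q \<alpha> w}"
    by (intro closed_Collect_le continuous_on_Q continuous_intros)
  then have "0 \<le> Q \<alpha> (complex_of_real v)" if "v > m\<^sub>0" for v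
    using neg_axis_closure[of "{w. 0 \<le> Q \<alpha> w}"] Q that by auto
  then show ?R
    using stieltjes_angle[of "cos \<alpha>" "sin \<alpha>" m\<^sub>0] by (simp add: Q_of_real)
next
  assume R: ?R
  have "v * sin \<alpha> \<noteq> cos \<alpha>" if "v > m\<^sub>0" for v
  proof
    assume "v * sin \<alpha> = cos \<alpha>"
    then have "cos \<alpha> / sin \<alpha> = v" using R by (simp add: nonzero_divide_eq_eq)
    then show False using R that by simp
  qed
  then have "extends_off_nonneg (\<lambda>z. - m_alpha m \<alpha> z)"
    by (rule m_alpha_extends)
  moreover have "0 \<le> Im (z * - m_alpha m \<alpha> z) / Im z" if "Im z \<noteq> 0" for z
  proof -
    have z: "z \<notin> \<real>" using that by (simp add: complex_is_Real_iff)
    have "0 \<le> Q \<alpha> (m z) + Re z * N z"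
      unfolding Q_def cmod_power2
      using R lower[OF nonreal_off_nonneg[OF z]] by (intro stieltjes_quadratic_nonneg) auto
    then show ?thesis
      unfolding m_alpha_stieltjes_quotient[OF z] using den_pos[OF z, of \<alpha>] by simp
  qed
  ultimately show ?L
    using m_alpha_herglotz by (simp add: stieltjes_def)
qed

text \<open>This is the preceding criterion with \<open>(sin \<alpha>, cos \<alpha>)\<close> replaced by \<open>(cos \<alpha>, - sin \<alpha>)\<close>, which changes the sign
  of \<open>Q \<alpha>\<close>: \<open>V\<close> is inverse Stieltjes exactly when \<open>- 1 / V\<close> is Stieltjes, and \<open>- 1 / V\<close> is the transform of
  \<open>m\<close> for the angle shifted by \<open>\<pi> / 2\<close>.\<close>

lemma inverse_stieltjes_m_alpha_iff:
  "inverse_stieltjes (\<lambda>z. - m_alpha m \<alpha> z) \<longleftrightarrow>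
     cos \<alpha> \<noteq> 0 \<and> 0 \<le> - sin \<alpha> / cos \<alpha> \<and> - sin \<alpha> / cos \<alpha> \<le> m\<^sub>0" (is "?L \<longleftrightarrow> ?R")
proof
  assume L: ?L
  have Q: "Q \<alpha> (m z) \<le> 0" if z: "z \<notin> \<real>" "Re z < 0" for z
  proof -
    have "Im z \<noteq> 0" using z by (simp add: complex_is_Real_iff)
    then have "0 \<le> Im (- m_alpha m \<alpha> z / z) / Im z"
      using L by (simp add: inverse_stieltjes_def)
    moreover have "den \<alpha> z * (cmod z)\<^sup>2 > 0" using den_pos[OF z(1), of \<alpha>] z(2) by (cases "z = 0") auto
    ultimately have "0 \<le> Re z * N z - Q \<alpha> (m z)"
      unfolding m_alpha_inverse_stieltjes_quotient[OF z(1)]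
      by (simp only: zero_le_divide_iff) auto
    moreover have "Re z * N z < 0"
      using z N_pos[OF nonreal_off_nonneg] by (simp add: mult_neg_pos)
    ultimately show ?thesis by simp
  qed
  have "closed {w. Q \<alpha> w \<le> 0}"
    by (intro closed_Collect_le continuous_on_Q continuous_intros)
  then have "Q \<alpha> (complex_of_real v) \<le> 0" if "v > m\<^sub>0" for v
    using neg_axis_closure[of "{w. Q \<alpha> w \<le> 0}"] Q that by auto
  then have "0 \<le> (cos \<alpha> * v - - sin \<alpha>) * (- sin \<alpha> * v + cos \<alpha>)" if "v > m\<^sub>0" for v
    using that by (simp add: Q_of_real algebra_simps)
  then show ?R
    using stieltjes_angle[of "- sin \<alpha>" "cos \<alpha>" m\<^sub>0] by simp
next
  assume R: ?R
  have "v * sin \<alpha> \<noteq> cos \<alpha>" if "v > m\<^sub>0" for v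
  proof
    assume "v * sin \<alpha> = cos \<alpha>"
    moreover have "v * (- sin \<alpha> / cos \<alpha>) = - (v * sin \<alpha>) / cos \<alpha>" by simp
    ultimately have "v * (- sin \<alpha> / cos \<alpha>) = - 1"
      using R by (simp only:) simp
    moreover have "0 \<le> v * (- sin \<alpha> / cos \<alpha>)"
      using R that by (intro mult_nonneg_nonneg) auto
    ultimately show False by linarith
  qed
  then have "extends_off_nonneg (\<lambda>z. - m_alpha m \<alpha> z)"
    by (rule m_alpha_extends)
  moreover have "0 \<le> Im (- m_alpha m \<alpha> z / z) / Im z" if "Im z \<noteq> 0" for z
  proof -
    have z: "z \<notin> \<real>" using that by (simp add: complex_is_Real_iff)
    have "0 \<le> ((cos \<alpha>)\<^sup>2 - (- sin \<alpha>)\<^sup>2) * Re (m z)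
        + cos \<alpha> * (- sin \<alpha>) * ((Re (m z))\<^sup>2 + (Im (m z))\<^sup>2 - 1) + Re z * N z"
      using R lower[OF nonreal_off_nonneg[OF z]] by (intro stieltjes_quadratic_nonneg) auto
    also have "\<dots> = Re z * N z - Q \<alpha> (m z)"
      unfolding Q_def cmod_power2 by (simp add: algebra_simps)
    finally show ?thesis
      unfolding m_alpha_inverse_stieltjes_quotient[OF z] using den_pos[OF z, of \<alpha>] by simp
  qed
  ultimately show ?L
    using m_alpha_herglotz by (simp add: inverse_stieltjes_def)
qed

end

context weyl_solutions
begin

lemma m_weyl_function:
  assumes lim: "((\<lambda>x. m (complex_of_real x)) \<longlongrightarrow> complex_of_real m\<^sub>0) (at_left 0)"
  shows "weyl_function m (\<lambda>z. L2_sq l (\<psi> z)) m\<^sub>0"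
proof
  have "open (- \<real>\<^sub>\<ge>\<^sub>0 :: complex set)" by (simp add: open_Compl)
  then show "m holomorphic_on - \<real>\<^sub>\<ge>\<^sub>0"
    using m_has_derivative by (auto simp: holomorphic_on_open)
  show "\<exists>x<0. B \<le> Re (m (complex_of_real x))" for B
  proof -
    obtain c where c: "c > 0" "\<And>n. n \<ge> 1 \<Longrightarrow> m\<^sub>0 + c * n \<le> Re (m (complex_of_real (- n\<^sup>2)))"
      using m_unbounded[OF lim] by blast
    define n where "n = max 1 ((B - m\<^sub>0) / c)"
    have "n \<ge> 1" "B - m\<^sub>0 \<le> c * n"
      using c(1) by (auto simp: n_def field_simps max_def)
    then show ?thesis
      using c(2)[of n] by (intro exI[of _ "- n\<^sup>2"]) auto
  qed
qed (use m_cnj Im_m \<psi>_pos m_lower_bound[OF lim] lim in auto)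

end

theorem mainTheorem2:
  fixes l m\<^sub>0 :: real and q :: "real \<Rightarrow> real" and m :: "complex \<Rightarrow> complex"
  assumes "l \<ge> 0"
    and "locally_summable l q"
    and "deficiency_indices l q = (1, 1)"
    and "nonnegative_op l (minimal_op l q)"
    and "weyl_titchmarsh l q m"
    and "((\<lambda>x. m (complex_of_real x)) \<longlongrightarrow> complex_of_real m\<^sub>0) (at_left 0)"
  shows "(stieltjes (\<lambda>z. 1 / m z) \<longleftrightarrow> m\<^sub>0 \<ge> 0) \<and>
    (inverse_stieltjes (\<lambda>z. - m z) \<longleftrightarrow> m\<^sub>0 \<ge> 0) \<and>
    (\<forall>\<alpha>::real.
      (stieltjes (\<lambda>z. - m_alpha m \<alpha> z) \<longleftrightarrow>
         0 < ext_recip m\<^sub>0 \<and> ext_recip m\<^sub>0 \<le> ext_tan \<alpha>) \<and>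
      (inverse_stieltjes (\<lambda>z. - m_alpha m \<alpha> z) \<longleftrightarrow>
         - ereal m\<^sub>0 \<le> ext_tan \<alpha> \<and> ext_tan \<alpha> \<le> 0))"
proof -
  have "\<exists>\<psi> \<psi>'. in_max_domain l q \<psi> \<psi>' (\<lambda>x. z * \<psi> x) \<and> \<psi> l = - 1 \<and> \<psi>' l = m z"
    if z: "z \<notin> \<real>\<^sub>\<ge>\<^sub>0" for z
  proof -
    obtain \<phi>\<^sub>1 \<phi>\<^sub>1' \<phi>\<^sub>2 \<phi>\<^sub>2' where sol: "sl_expr l q \<phi>\<^sub>1 \<phi>\<^sub>1' (\<lambda>x. z * \<phi>\<^sub>1 x)" "\<phi>\<^sub>1 l = 0" "\<phi>\<^sub>1' l = 1"
        "sl_expr l q \<phi>\<^sub>2 \<phi>\<^sub>2' (\<lambda>x. z * \<phi>\<^sub>2 x)" "\<phi>\<^sub>2 l = - 1" "\<phi>\<^sub>2' l = 0"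
        "square_integrable l (\<lambda>x. \<phi>\<^sub>2 x + m z * \<phi>\<^sub>1 x)"
      using assms(5) z unfolding weyl_titchmarsh_def by blast
    let ?\<psi> = "\<lambda>x. \<phi>\<^sub>2 x + m z * \<phi>\<^sub>1 x"
    have "sl_expr l q ?\<psi> (\<lambda>x. \<phi>\<^sub>2' x + m z * \<phi>\<^sub>1' x) (\<lambda>x. z * ?\<psi> x)"
      using sl_expr_add[OF sol(4) sol(1), of "m z"] by (simp add: algebra_simps)
    then show ?thesis
      using sol square_integrable_scale[OF sol(7), of z]
      by (intro exI[of _ ?\<psi>] exI[of _ "\<lambda>x. \<phi>\<^sub>2' x + m z * \<phi>\<^sub>1' x"]) (simp add: in_max_domain_def)
  qed
  then obtain \<psi> \<psi>' where \<psi>: "\<And>z. z \<notin> \<real>\<^sub>\<ge>\<^sub>0 \<Longrightarrow>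
      in_max_domain l q (\<psi> z) (\<psi>' z) (\<lambda>x. z * \<psi> z x) \<and> \<psi> z l = - 1 \<and> \<psi>' z l = m z"
    by metis
  obtain \<phi> \<phi>' where \<phi>: "sl_expr l q \<phi> \<phi>' (\<lambda>x. - 1 * \<phi> x)" "\<phi> l = 0" "\<phi>' l = 1"
    using assms(5) minus_1_off_nonneg unfolding weyl_titchmarsh_def by blast
  interpret weyl_solutions l q m \<psi> \<psi>' \<phi> \<phi>'
    by unfold_locales (use assms(4) \<psi> \<phi> in auto)
  interpret F: weyl_function m "\<lambda>z. L2_sq l (\<psi> z)" m\<^sub>0
    using assms(6) by (rule m_weyl_function)
  \<comment> \<open>At a zero of \<open>m\<close> both sides of the first identity are \<open>0\<close>, by \<open>1 / 0 = 0\<close>.\<close>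
  have "(\<lambda>z. 1 / m z) = (\<lambda>z. - m_alpha m (pi / 2) z)" "(\<lambda>z. - m z) = (\<lambda>z. - m_alpha m 0 z)"
    by (auto simp: m_alpha_def fun_eq_iff)
  then have "stieltjes (\<lambda>z. 1 / m z) \<longleftrightarrow> m\<^sub>0 \<ge> 0" "inverse_stieltjes (\<lambda>z. - m z) \<longleftrightarrow> m\<^sub>0 \<ge> 0"
    using F.stieltjes_m_alpha_iff[of "pi / 2"] F.inverse_stieltjes_m_alpha_iff[of 0] by simp_all
  then show ?thesis
    using F.stieltjes_m_alpha_iff F.inverse_stieltjes_m_alpha_iff
    by (simp only: ext_recip_le_ext_tan_iff minus_le_ext_tan_iff) simp
qed

end
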